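(* Let $L/K$ be a finite-dimensional normal field extension with Galois group $G$ (the group of automorphisms of $L$ over $K$), and let $S=G(\star)$ be a modification of $G$. Let $U$ be the group of invertible elements of $S$, and suppose that $U$ is normal in $S$, i.e. $x\star U=U\star x$ for all $x\in S$. Let $P=\{\ell\in L: u(\ell)=\ell \text{ for all } u\in U\}$ be the subfield of $U$-fixed elements, let $S/U$ be the quotient semigroup of $S$ by the congruence whose classes are $\{0\}$ and the cosets of $U$, and let $L^{\times}$, $P^{\times}$ be regarded as 0-modules over $S$, $S/U$ respectively via the Galois action. Let $$\psi: H_0^2(S/U,P^{\times})\to H_0^2(S,L^{\times})$$ be the homomorphism induced by the projection $S\to S/U$ and the inclusion $P^{\times}\hookrightarrow L^{\times}$, and let $$\varphi: H_0^2(S,L^{\times})\to H^2(U,L^{\times})$$ be the homomorphism induced by restricting 0-cocycles to $U$. Then the sequence $$0\longrightarrow H^2_0(S/U, P^{\times})\stackrel{\psi}{\longrightarrow} H_0^2(S,L^{\times})\stackrel{\varphi}{\longrightarrow} H^2(U,L^{\times})$$ is exact.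
   Context: **0-modules.** Let $S$ be a semigroup with zero $0$. An abelian group $A$ (written additively) is a 0-module over $S$ if there is an action $(S\setminus 0)\times A\to A$ such that $s(a+b)=sa+sb$ for all $s\in S\setminus 0$, $a,b\in A$, and $s(ta)=(st)a$ whenever $s,t\in S\setminus 0$ and $st\neq 0$. **0-cohomology.** An $n$-dimensional 0-cochain is a function to $A$ defined on exactly those $n$-tuples $(s_1,\dots,s_n)$ of elements of $S$ with $s_1\cdots s_n\ne 0$; these form a group $C^n_0(S,A)$ under pointwise addition. The coboundary operator $\partial^n: C^n_0(S,A)\to C^{n+1}_0(S,A)$ is $$\partial^nf(s_1,\dots,s_{n+1})=s_1f(s_2,\dots,s_{n+1})+\sum_{i=1}^n(-1)^if(s_1,\dots,s_is_{i+1},\dots,s_{n+1})+(-1)^{n+1}f(s_1,\dots,s_n)$$ for $s_1\cdots s_{n+1}\neq 0$. One has $\partial^{n+1}\partial^{n}=0$. The 0-cocycles are $Z^n_0(S,A)=\ker\partial^n$, and $H^n_0(S,A)=Z^n_0(S,A)/\operatorname{im}\partial^{n-1}$ is the $n$-th 0-cohomology group. For a group $U$, $H^n(U,A)$ denotes ordinary group cohomology (defined by the same formulas on all tuples). **Modifications.** A modification $G(\star)$ of a group $G$ is a semigroup on the set $G\cup\{0\}$ (with $0\notin G$) whose associative operation $\star$ satisfies: for all $x,y\in G$, $x\star y$ equals either $xy$ (the product in $G$) or $0$; $0\star x=x\star 0=0\star 0=0$; and the identity element of $G$ is also the identity element of $G(\star)$. The group $U$ of invertible elements of $G(\star)$ is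 a subgroup of $G$. **Module structures.** $L^{\times}$ (the multiplicative group of $L$, with its group operation playing the role of addition above) is a 0-module over $S=G(\star)$, with elements of $S\setminus 0=G$ acting as automorphisms of $L$. When $U$ is normal in $S$, the cosets $x\star U=U\star x$ ($x\in S\setminus 0$) together with $\{0\}$ are the classes of a congruence on $S$, giving the quotient semigroup with zero $S/U$. The group $P^{\times}$ is a 0-module over $S/U$, where the class of $x\in S\setminus 0$ acts on $P^\times$ as $x$ does. *)

theory Defs
  imports "HOL-Algebra.Algebra"
begin

section \<open>Semigroups with zero and 0-modules\<close>

text \<open>
  A semigroup with zero is given by a record \<open>S\<close> of the library's monoid type, of which only the
  carrier and the multiplication are used, together with its zero element \<open>z\<close>.
\<close>

locale zero_semigroup =
  fixes S (structure) and z
  assumes zs_closed: "x \<in> carrier S \<Longrightarrow> y \<in> carrier S \<Longrightarrow> x \<otimes> y \<in> carrier S"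
    and zs_assoc: "x \<in> carrier S \<Longrightarrow> y \<in> carrier S \<Longrightarrow> w \<in> carrier S \<Longrightarrow>
      x \<otimes> y \<otimes> w = x \<otimes> (y \<otimes> w)"
    and zs_zero: "z \<in> carrier S"
    and zs_zero_left: "x \<in> carrier S \<Longrightarrow> z \<otimes> x = z"
    and zs_zero_right: "x \<in> carrier S \<Longrightarrow> x \<otimes> z = z"

text \<open>
  The coefficient group \<open>A\<close> is written multiplicatively, as everywhere in the group library.
\<close>

locale zero_module = zero_semigroup S z + A: comm_group A
  for S :: "('s, 'c) monoid_scheme" (structure) and z and A :: "('a, 'd) monoid_scheme" +
  fixes act :: "'s \<Rightarrow> 'a \<Rightarrow> 'a"
  assumes act_closed: "s \<in> carrier S - {z} \<Longrightarrow> a \<in> carrier A \<Longrightarrow> act s a \<in> carrier A"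
    and act_mult: "s \<in> carrier S - {z} \<Longrightarrow> a \<in> carrier A \<Longrightarrow> b \<in> carrier A \<Longrightarrow>
      act s (a \<otimes>\<^bsub>A\<^esub> b) = act s a \<otimes>\<^bsub>A\<^esub> act s b"
    and act_act: "s \<in> carrier S - {z} \<Longrightarrow> t \<in> carrier S - {z} \<Longrightarrow> s \<otimes> t \<noteq> z \<Longrightarrow>
      a \<in> carrier A \<Longrightarrow> act s (act t a) = act (s \<otimes> t) a"


section \<open>Cohomology\<close>

text \<open>
  0-cohomology of a semigroup and ordinary group cohomology are given by the same formulas and
  differ only in the tuples on which an \<open>n\<close>-cochain is defined.  The parameter \<open>D\<close> below
  prescribes, for each \<open>n\<close>, this set of \<open>n\<close>-tuples, which are lists of length \<open>n\<close>.
  Cochains are extensional, i.e. \<open>undefined\<close> outside \<open>D n\<close>.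
\<close>

definition cochains :: "(nat \<Rightarrow> 's list set) \<Rightarrow> ('a, 'd) monoid_scheme \<Rightarrow> nat \<Rightarrow> ('s list \<Rightarrow> 'a) monoid"
  where "cochains D A n = product_group (D n) (\<lambda>_. A)"

text \<open>
  \<open>contract M i (s\<^sub>1, \<dots>, s\<^sub>n\<^sub>+\<^sub>1) = (s\<^sub>1, \<dots>, s\<^sub>i s\<^sub>i\<^sub>+\<^sub>1, \<dots>, s\<^sub>n\<^sub>+\<^sub>1)\<close> for \<open>1 \<le> i \<le> n\<close>; list positions start at 0.
\<close>

definition contract :: "('s, 'c) monoid_scheme \<Rightarrow> nat \<Rightarrow> 's list \<Rightarrow> 's list"
  where "contract M i s = take (i - 1) s @ [s ! (i - 1) \<otimes>\<^bsub>M\<^esub> s ! i] @ drop (i + 1) s"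

text \<open>
  In multiplicative notation the sign \<open>(-1)\<^sup>i\<close> becomes an exponent.
\<close>

definition coboundary ::
    "(nat \<Rightarrow> 's list set) \<Rightarrow> ('s, 'c) monoid_scheme \<Rightarrow> ('a, 'd) monoid_scheme \<Rightarrow> ('s \<Rightarrow> 'a \<Rightarrow> 'a) \<Rightarrow>
      nat \<Rightarrow> ('s list \<Rightarrow> 'a) \<Rightarrow> ('s list \<Rightarrow> 'a)"
  where "coboundary D M A act n f = (\<lambda>s\<in>D (Suc n).
    act (hd s) (f (tl s))
    \<otimes>\<^bsub>A\<^esub> (\<Otimes>\<^bsub>A\<^esub>i\<in>{1..n}. f (contract M i s) [^]\<^bsub>A\<^esub> ((-1) ^ i :: int))
    \<otimes>\<^bsub>A\<^esub> f (butlast s) [^]\<^bsub>A\<^esub> ((-1) ^ Suc n :: int))"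

definition cocycles ::
    "(nat \<Rightarrow> 's list set) \<Rightarrow> ('s, 'c) monoid_scheme \<Rightarrow> ('a, 'd) monoid_scheme \<Rightarrow> ('s \<Rightarrow> 'a \<Rightarrow> 'a) \<Rightarrow>
      nat \<Rightarrow> ('s list \<Rightarrow> 'a) set"
  where "cocycles D M A act n =
    kernel (cochains D A n) (cochains D A (Suc n)) (coboundary D M A act n)"

definition coboundaries ::
    "(nat \<Rightarrow> 's list set) \<Rightarrow> ('s, 'c) monoid_scheme \<Rightarrow> ('a, 'd) monoid_scheme \<Rightarrow> ('s \<Rightarrow> 'a \<Rightarrow> 'a) \<Rightarrow>
      nat \<Rightarrow> ('s list \<Rightarrow> 'a) set"
  where "coboundaries D M A act n = (case n of
      0 \<Rightarrow> {\<one>\<^bsub>cochains D A 0\<^esub>}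
    | Suc m \<Rightarrow> coboundary D M A act m ` carrier (cochains D A m))"

definition cohomology ::
    "(nat \<Rightarrow> 's list set) \<Rightarrow> ('s, 'c) monoid_scheme \<Rightarrow> ('a, 'd) monoid_scheme \<Rightarrow> ('s \<Rightarrow> 'a \<Rightarrow> 'a) \<Rightarrow>
      nat \<Rightarrow> ('s list \<Rightarrow> 'a) set monoid"
  where "cohomology D M A act n =
    (cochains D A n)\<lparr>carrier := cocycles D M A act n\<rparr> Mod coboundaries D M A act n"

text \<open>
  The empty tuple, whose product does not exist in a semigroup, is admitted for \<open>n = 0\<close>, so that
  0-dimensional 0-cochains are the elements of the module.
\<close>

definition zero_tuples :: "('s, 'c) monoid_scheme \<Rightarrow> 's \<Rightarrow> nat \<Rightarrow> 's list set"
  where "zero_tuples S z n = {s. length s = n \<and> set s \<subseteq> carrier S \<and>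
    (s \<noteq> [] \<longrightarrow> foldl (\<otimes>\<^bsub>S\<^esub>) (hd s) (tl s) \<noteq> z)}"

definition all_tuples :: "('s, 'c) monoid_scheme \<Rightarrow> nat \<Rightarrow> 's list set"
  where "all_tuples U n = {s. length s = n \<and> set s \<subseteq> carrier U}"

abbreviation zero_cohomology ::
    "('s, 'c) monoid_scheme \<Rightarrow> 's \<Rightarrow> ('a, 'd) monoid_scheme \<Rightarrow> ('s \<Rightarrow> 'a \<Rightarrow> 'a) \<Rightarrow>
      nat \<Rightarrow> ('s list \<Rightarrow> 'a) set monoid"
  where "zero_cohomology S z A act n \<equiv> cohomology (zero_tuples S z) S A act n"

abbreviation group_cohomology ::
    "('s, 'c) monoid_scheme \<Rightarrow> ('a, 'd) monoid_scheme \<Rightarrow> ('s \<Rightarrow> 'a \<Rightarrow> 'a) \<Rightarrow>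
      nat \<Rightarrow> ('s list \<Rightarrow> 'a) set monoid"
  where "group_cohomology U A act n \<equiv> cohomology (all_tuples U) U A act n"

text \<open>
  The map of quotient groups induced by a map \<open>h\<close> of cochains: if \<open>h\<close> is a homomorphism taking
  coboundaries to elements of \<open>B\<close>, the class \<open>c\<close> of \<open>f\<close> is sent to the class \<open>B #> h f\<close>.  If \<open>h\<close>
  did not respect classes, \<open>B <#> h ` c\<close> would be a union of several cosets of \<open>B\<close>, hence not
  an element of the target group.
\<close>

definition induced_map ::
    "('f, 'c) monoid_scheme \<Rightarrow> 'f set \<Rightarrow> ('e \<Rightarrow> 'f) \<Rightarrow> 'e set \<Rightarrow> 'f set"
  where "induced_map C B h c = B <#>\<^bsub>C\<^esub> (h ` c)"

text \<open>
  The homomorphism induced by a projection \<open>p\<close> from \<open>S\<close> and the inclusion of a subgroup of \<open>A\<close>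
  (the coefficients of the cochains on the target of \<open>p\<close>) in \<open>A\<close>.  The inclusion leaves the values
  of cochains unchanged and so does not show in the formula.
\<close>

definition inflation ::
    "('s, 'c) monoid_scheme \<Rightarrow> 's \<Rightarrow> ('a, 'd) monoid_scheme \<Rightarrow> ('s \<Rightarrow> 'a \<Rightarrow> 'a) \<Rightarrow> ('s \<Rightarrow> 't) \<Rightarrow>
      nat \<Rightarrow> ('t list \<Rightarrow> 'a) set \<Rightarrow> ('s list \<Rightarrow> 'a) set"
  where "inflation S z A act p n =
    induced_map (cochains (zero_tuples S z) A n) (coboundaries (zero_tuples S z) S A act n)
      (\<lambda>f. \<lambda>s\<in>zero_tuples S z n. f (map p s))"

definition restriction ::
    "('s, 'c) monoid_scheme \<Rightarrow> ('a, 'd) monoid_scheme \<Rightarrow> ('s \<Rightarrow> 'a \<Rightarrow> 'a) \<Rightarrow>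
      nat \<Rightarrow> ('s list \<Rightarrow> 'a) set \<Rightarrow> ('s list \<Rightarrow> 'a) set"
  where "restriction U A act n =
    induced_map (cochains (all_tuples U) A n) (coboundaries (all_tuples U) U A act n)
      (\<lambda>f. restrict f (all_tuples U n))"


section \<open>Modifications of a group\<close>

locale modification = G: group G + S: monoid S
  for G :: "('g, 'b) monoid_scheme" and S :: "('g, 'c) monoid_scheme" +
  fixes z :: 'g
  assumes zero_notin: "z \<notin> carrier G"
    and carrier_S: "carrier S = insert z (carrier G)"
    and mult_S: "x \<in> carrier G \<Longrightarrow> y \<in> carrier G \<Longrightarrow>
      x \<otimes>\<^bsub>S\<^esub> y = x \<otimes>\<^bsub>G\<^esub> y \<or> x \<otimes>\<^bsub>S\<^esub> y = z"
    and zero_mult: "x \<in> carrier S \<Longrightarrow> z \<otimes>\<^bsub>S\<^esub> x = z"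
    and mult_zero: "x \<in> carrier S \<Longrightarrow> x \<otimes>\<^bsub>S\<^esub> z = z"
    and one_S: "\<one>\<^bsub>S\<^esub> = \<one>\<^bsub>G\<^esub>"


section \<open>Normal extensions and Galois groups\<close>

definition (in ring) normal_extension :: "'a set \<Rightarrow> bool"
  where "normal_extension K \<longleftrightarrow>
    (\<forall>x \<in> carrier R. (algebraic over K) x) \<and>
    (\<forall>p \<in> carrier (K[X]). pirreducible K p \<and> (\<exists>x \<in> carrier R. eval p x = \<zero>) \<longrightarrow> splitted p)"

definition (in ring) galois_group :: "'a set \<Rightarrow> ('a \<Rightarrow> 'a) monoid"
  where "galois_group K = BijGroup (carrier R)
    \<lparr>carrier := {\<sigma> \<in> ring_hom R R \<inter> Bij (carrier R). \<forall>k \<in> K. \<sigma> k = k}\<rparr>"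

text \<open>
  The action of the quotient \<open>S Mod U\<close> on the \<open>U\<close>-fixed elements: all members of a nonzero class
  have the same effect on such an element.
\<close>

definition coset_act :: "('l \<Rightarrow> 'l) set \<Rightarrow> 'l \<Rightarrow> 'l"
  where "coset_act C l = the_elem ((\<lambda>x. x l) ` C)"

section \<open>The modules of a modification of a Galois group\<close>

lemma (in ring) galois_group_subgroup:
  assumes "K \<subseteq> carrier R"
  shows "subgroup (carrier (galois_group K)) (BijGroup (carrier R))"
proof (rule subgroup.intro)
  let ?A = "{\<sigma> \<in> ring_hom R R \<inter> Bij (carrier R). \<forall>k \<in> K. \<sigma> k = k}"
  have car: "carrier (galois_group K) = ?A" by (simp add: galois_group_def)
  show "carrier (galois_group K) \<subseteq> carrier (BijGroup (carrier R))"
    by (auto simp: car BijGroup_def)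
  show "\<one>\<^bsub>BijGroup (carrier R)\<^esub> \<in> carrier (galois_group K)"
    using assms by (auto simp: car BijGroup_def id_Bij ring_hom_def)
  fix f assume f: "f \<in> carrier (galois_group K)"
  then have fB: "f \<in> Bij (carrier R)" and fh: "f \<in> ring_hom R R" and fK: "\<forall>k\<in>K. f k = k"
    by (auto simp: car)
  show "f \<otimes>\<^bsub>BijGroup (carrier R)\<^esub> g \<in> carrier (galois_group K)"
    if g: "g \<in> carrier (galois_group K)" for g
  proof -
    have gB: "g \<in> Bij (carrier R)" and gh: "g \<in> ring_hom R R" and gK: "\<forall>k\<in>K. g k = k"
      using g by (auto simp: car)
    have "compose (carrier R) f g \<in> ring_hom R R"
      using fh gh by (auto simp: ring_hom_def compose_def Pi_iff)
    moreover have "\<forall>k\<in>K. compose (carrier R) f g k = k"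
      using assms fK gK by (auto simp: compose_def)
    ultimately show ?thesis
      using fB gB by (simp add: car BijGroup_def compose_Bij)
  qed
  let ?g = "restrict (inv_into (carrier R) f) (carrier R)"
  have bij: "bij_betw f (carrier R) (carrier R)" using fB by (simp add: Bij_def)
  have inv1: "inv_into (carrier R) f (f x) = x" if "x \<in> carrier R" for x
    using bij that by (simp add: bij_betw_inv_into_left)
  have inv2: "f (inv_into (carrier R) f x) = x" if "x \<in> carrier R" for x
    using bij that by (simp add: bij_betw_inv_into_right)
  have invc: "inv_into (carrier R) f x \<in> carrier R" if "x \<in> carrier R" for x
    using Bij_inv_into_mem[OF fB that] .
  have "?g \<in> ring_hom R R"
  proof (rule ring_hom_memI)
    fix x y assume xy: "x \<in> carrier R" "y \<in> carrier R"
    let ?x = "inv_into (carrier R) f x" and ?y = "inv_into (carrier R) f y"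
    show "?g x \<in> carrier R" using invc xy by simp
    have "f (?x \<otimes> ?y) = x \<otimes> y" "f (?x \<oplus> ?y) = x \<oplus> y"
      using fh xy invc inv2 by (auto simp: ring_hom_def)
    then show "?g (x \<otimes> y) = ?g x \<otimes> ?g y" "?g (x \<oplus> y) = ?g x \<oplus> ?g y"
      using inv1[of "?x \<otimes> ?y"] inv1[of "?x \<oplus> ?y"] xy invc by auto
  next
    have "f \<one> = \<one>" using fh by (simp add: ring_hom_def)
    then show "?g \<one> = \<one>" using inv1[of \<one>] by simp
  qed
  moreover have "?g k = k" if "k \<in> K" for k
  proof -
    have "k \<in> carrier R" "f k = k" using that assms fK by auto
    then show ?thesis using inv1[of k] by simp
  qed
  ultimately show "inv\<^bsub>BijGroup (carrier R)\<^esub> f \<in> carrier (galois_group K)"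
    using fB by (simp add: car inv_BijGroup restrict_inv_into_Bij del: restrict_apply)
qed

lemma (in ring) galois_group_is_group:
  assumes "K \<subseteq> carrier R"
  shows "group (galois_group K)"
  using subgroup.subgroup_is_group[OF galois_group_subgroup[OF assms] group_BijGroup]
  by (simp add: galois_group_def)

lemma (in ring) galois_groupD:
  assumes "f \<in> carrier (galois_group K)"
  shows "f \<in> ring_hom R R" "f \<in> Bij (carrier R)"
  using assms by (auto simp: galois_group_def)

lemma (in ring) galois_group_mult:
  assumes "f \<in> carrier (galois_group K)" "g \<in> carrier (galois_group K)" "x \<in> carrier R"
  shows "(f \<otimes>\<^bsub>galois_group K\<^esub> g) x = f (g x)"
  using assms by (simp add: galois_group_def BijGroup_def compose_def)

lemma (in modification) zero_semigroup: "zero_semigroup S z"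
proof
  show "z \<in> carrier S" unfolding carrier_S by blast
qed (fact S.m_closed S.m_assoc zero_mult mult_zero)+

lemma (in modification) zero_not_unit: "z \<notin> Units S"
  using zero_mult zero_notin one_S unfolding Units_def by fastforce

lemma (in modification) unit_nonzero: "u \<in> Units S \<Longrightarrow> u \<in> carrier S - {z}"
  using zero_not_unit S.Units_closed by auto

lemma (in modification) Units_subset: "Units S \<subseteq> carrier G"
  using zero_not_unit carrier_S by (auto simp: Units_def)

lemma (in modification) mult_S_nonzero:
  assumes "x \<in> carrier G" "y \<in> carrier G" "x \<otimes>\<^bsub>S\<^esub> y \<noteq> z"
  shows "x \<otimes>\<^bsub>S\<^esub> y = x \<otimes>\<^bsub>G\<^esub> y"
  using assms mult_S by blast

lemma (in modification) unit_mult_nonzero: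
  assumes "u \<in> Units S" "x \<in> carrier G"
  shows "u \<otimes>\<^bsub>S\<^esub> x \<noteq> z" "x \<otimes>\<^bsub>S\<^esub> u \<noteq> z"
proof -
  have x: "x \<in> carrier S" "x \<noteq> z" using assms(2) carrier_S zero_notin by auto
  obtain v where v: "v \<in> carrier S" "v \<otimes>\<^bsub>S\<^esub> u = \<one>\<^bsub>S\<^esub>" "u \<otimes>\<^bsub>S\<^esub> v = \<one>\<^bsub>S\<^esub>"
    using assms(1) by (auto simp: Units_def)
  have u: "u \<in> carrier S" using assms(1) by (rule S.Units_closed)
  show "u \<otimes>\<^bsub>S\<^esub> x \<noteq> z"
    using S.m_assoc[OF v(1) u x(1)] v x mult_zero by auto
  show "x \<otimes>\<^bsub>S\<^esub> u \<noteq> z"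
    using S.m_assoc[OF x(1) u v(1)] v x zero_mult by auto
qed

text \<open>
  The quotient \<open>S Mod Units S\<close> of the library, whose elements are the cosets of \<open>Units S\<close> with
  elementwise multiplication, is the quotient of \<open>S\<close> by the congruence in question; its zero is
  the coset \<open>{z}\<close> of \<open>z\<close>.
\<close>

lemma (in modification) coset_zero: "Units S #>\<^bsub>S\<^esub> z = {z}"
  using zero_not_unit S.Units_one_closed mult_zero S.Units_closed
  by (auto simp: r_coset_def)

lemma (in modification) coset_eq_zero_iff:
  assumes "x \<in> carrier S"
  shows "Units S #>\<^bsub>S\<^esub> x = {z} \<longleftrightarrow> x = z"
proof
  assume "Units S #>\<^bsub>S\<^esub> x = {z}"
  moreover have "\<one>\<^bsub>S\<^esub> \<otimes>\<^bsub>S\<^esub> x \<in> Units S #>\<^bsub>S\<^esub> x" by (auto simp: r_coset_def)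
  ultimately show "x = z" using assms by auto
qed (simp add: coset_zero)

lemma (in modification) coset_mult:
  assumes norm: "\<forall>x \<in> carrier S. x <#\<^bsub>S\<^esub> Units S = Units S #>\<^bsub>S\<^esub> x"
    and x: "x \<in> carrier S" and y: "y \<in> carrier S"
  shows "(Units S #>\<^bsub>S\<^esub> x) <#>\<^bsub>S\<^esub> (Units S #>\<^bsub>S\<^esub> y) = Units S #>\<^bsub>S\<^esub> (x \<otimes>\<^bsub>S\<^esub> y)"
proof (intro equalityI subsetI)
  fix a assume "a \<in> (Units S #>\<^bsub>S\<^esub> x) <#>\<^bsub>S\<^esub> (Units S #>\<^bsub>S\<^esub> y)"
  then obtain u v where u: "u \<in> Units S" and v: "v \<in> Units S"
    and a: "a = (u \<otimes>\<^bsub>S\<^esub> x) \<otimes>\<^bsub>S\<^esub> (v \<otimes>\<^bsub>S\<^esub> y)"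
    by (auto simp: set_mult_def r_coset_def)
  have "x \<otimes>\<^bsub>S\<^esub> v \<in> x <#\<^bsub>S\<^esub> Units S" using v by (auto simp: l_coset_def)
  then obtain w where w: "w \<in> Units S" and xv: "x \<otimes>\<^bsub>S\<^esub> v = w \<otimes>\<^bsub>S\<^esub> x"
    using norm x by (auto simp: r_coset_def)
  note c = S.Units_closed[OF u] S.Units_closed[OF v] S.Units_closed[OF w]
  have "a = u \<otimes>\<^bsub>S\<^esub> ((x \<otimes>\<^bsub>S\<^esub> v) \<otimes>\<^bsub>S\<^esub> y)"
    using c x y by (simp add: a S.m_assoc)
  also have "\<dots> = (u \<otimes>\<^bsub>S\<^esub> w) \<otimes>\<^bsub>S\<^esub> (x \<otimes>\<^bsub>S\<^esub> y)"
    using c x y by (simp add: xv S.m_assoc)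
  finally show "a \<in> Units S #>\<^bsub>S\<^esub> (x \<otimes>\<^bsub>S\<^esub> y)"
    using S.Units_m_closed[OF u w] by (auto simp: r_coset_def)
next
  fix a assume "a \<in> Units S #>\<^bsub>S\<^esub> (x \<otimes>\<^bsub>S\<^esub> y)"
  then obtain u where u: "u \<in> Units S" and a: "a = u \<otimes>\<^bsub>S\<^esub> (x \<otimes>\<^bsub>S\<^esub> y)"
    by (auto simp: r_coset_def)
  have "a = (u \<otimes>\<^bsub>S\<^esub> x) \<otimes>\<^bsub>S\<^esub> (\<one>\<^bsub>S\<^esub> \<otimes>\<^bsub>S\<^esub> y)"
    using S.Units_closed[OF u] x y by (simp add: a S.m_assoc)
  then show "a \<in> (Units S #>\<^bsub>S\<^esub> x) <#>\<^bsub>S\<^esub> (Units S #>\<^bsub>S\<^esub> y)"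
    using u S.Units_one_closed by (auto simp: set_mult_def r_coset_def)
qed

lemma (in modification) quotient_zero_semigroup:
  assumes norm: "\<forall>x \<in> carrier S. x <#\<^bsub>S\<^esub> Units S = Units S #>\<^bsub>S\<^esub> x"
  shows "zero_semigroup (S Mod Units S) {z}"
proof -
  have z: "z \<in> carrier S" using carrier_S by simp
  note m = coset_mult[OF norm]
  have car: "carrier (S Mod Units S) = (\<lambda>x. Units S #>\<^bsub>S\<^esub> x) ` carrier S"
    by (auto simp: FactGroup_def RCOSETS_def)
  have mult: "C \<otimes>\<^bsub>S Mod Units S\<^esub> D = C <#>\<^bsub>S\<^esub> D" for C D
    by (simp add: FactGroup_def)
  show ?thesis
  proof
    fix C D E
    assume C: "C \<in> carrier (S Mod Units S)"
    then obtain x where x: "x \<in> carrier S" "C = Units S #>\<^bsub>S\<^esub> x" using car by blast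
    show "{z} \<otimes>\<^bsub>S Mod Units S\<^esub> C = {z}" "C \<otimes>\<^bsub>S Mod Units S\<^esub> {z} = {z}"
      using m[OF z x(1)] m[OF x(1) z] zero_mult[OF x(1)] mult_zero[OF x(1)]
      by (simp_all only: mult x(2) coset_zero)
    assume D: "D \<in> carrier (S Mod Units S)"
    then obtain y where y: "y \<in> carrier S" "D = Units S #>\<^bsub>S\<^esub> y" using car by blast
    show "C \<otimes>\<^bsub>S Mod Units S\<^esub> D \<in> carrier (S Mod Units S)"
      using x y S.m_closed[OF x(1) y(1)] by (simp add: mult m car)
    assume E: "E \<in> carrier (S Mod Units S)"
    then obtain w where w: "w \<in> carrier S" "E = Units S #>\<^bsub>S\<^esub> w" using car by blast
    show "C \<otimes>\<^bsub>S Mod Units S\<^esub> D \<otimes>\<^bsub>S Mod Units S\<^esub> E =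
        C \<otimes>\<^bsub>S Mod Units S\<^esub> (D \<otimes>\<^bsub>S Mod Units S\<^esub> E)"
      using x y w by (simp add: mult m S.m_assoc)
  next
    show "{z} \<in> carrier (S Mod Units S)" unfolding car using z coset_zero by blast
  qed
qed

locale galois_modification = L: field L + modification "ring.galois_group L K" S z
  for L :: "('l, 'm) ring_scheme" and K and S :: "('l \<Rightarrow> 'l, 'c) monoid_scheme" and z +
  assumes K: "subfield K L"
begin

abbreviation "fixed_elements \<equiv> {l \<in> carrier L. \<forall>u \<in> Units S. u l = l}"

lemma elem_hom:
  assumes "s \<in> carrier S - {z}"
  shows "s \<in> carrier (L.galois_group K)" "s \<in> ring_hom L L" "s \<in> Bij (carrier L)"
    and "ring_hom_ring L L s"
proof -
  show s: "s \<in> carrier (L.galois_group K)" using assms carrier_S by auto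
  then show h: "s \<in> ring_hom L L" "s \<in> Bij (carrier L)" by (auto dest: L.galois_groupD)
  show "ring_hom_ring L L s"
    using h L.ring_axioms by (simp add: ring_hom_ring_def ring_hom_ring_axioms_def)
qed

lemma elem_apply_mult:
  assumes "s \<in> carrier S - {z}" "t \<in> carrier S - {z}" "s \<otimes>\<^bsub>S\<^esub> t \<noteq> z" "x \<in> carrier L"
  shows "s (t x) = (s \<otimes>\<^bsub>S\<^esub> t) x"
  using assms mult_S_nonzero[of s t] L.galois_group_mult[of s K t x] elem_hom(1) by simp

lemma elem_nonzero:
  assumes "s \<in> carrier S - {z}" "x \<in> carrier L - {\<zero>\<^bsub>L\<^esub>}"
  shows "s x \<in> carrier L - {\<zero>\<^bsub>L\<^esub>}"
proof -
  interpret s: ring_hom_ring L L s by (rule elem_hom(4)[OF assms(1)])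
  have inj: "inj_on s (carrier L)"
    using elem_hom(3)[OF assms(1)] by (simp add: Bij_def bij_betw_def)
  have x: "x \<in> carrier L" "x \<noteq> \<zero>\<^bsub>L\<^esub>" using assms(2) by auto
  have "s x \<noteq> s \<zero>\<^bsub>L\<^esub>" using inj_on_eq_iff[OF inj x(1) L.zero_closed] x(2) by blast
  then show ?thesis using x(1) by simp
qed

lemma units_zero_module: "zero_module S z (units_of L) (\<lambda>\<sigma>. \<sigma>)"
proof -
  have car: "carrier (units_of L) = carrier L - {\<zero>\<^bsub>L\<^esub>}"
    by (simp add: units_of_carrier L.field_Units)
  show ?thesis
  proof (intro zero_module.intro zero_module_axioms.intro)
    show "zero_semigroup S z" by (rule zero_semigroup)
    show "comm_group (units_of L)" by (rule L.units_comm_group)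
  next
    fix s a assume "s \<in> carrier S - {z}" "a \<in> carrier (units_of L)"
    then show "s a \<in> carrier (units_of L)" using elem_nonzero car by simp
  next
    fix s a b assume "s \<in> carrier S - {z}" "a \<in> carrier (units_of L)" "b \<in> carrier (units_of L)"
    then show "s (a \<otimes>\<^bsub>units_of L\<^esub> b) = s a \<otimes>\<^bsub>units_of L\<^esub> s b"
      using elem_hom(2)[of s] car by (auto simp: units_of_mult ring_hom_def)
  next
    fix s t a assume "s \<in> carrier S - {z}" "t \<in> carrier S - {z}" "s \<otimes>\<^bsub>S\<^esub> t \<noteq> z"
      "a \<in> carrier (units_of L)"
    then show "s (t a) = (s \<otimes>\<^bsub>S\<^esub> t) a" using elem_apply_mult car by simp
  qed
qed

lemma fixed_elementsI:
  "l \<in> carrier L \<Longrightarrow> (\<And>u. u \<in> Units S \<Longrightarrow> u l = l) \<Longrightarrow> l \<in> fixed_elements"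
  by blast

lemma fixed_elementsD:
  assumes "l \<in> fixed_elements"
  shows "l \<in> carrier L" and "u \<in> Units S \<Longrightarrow> u l = l"
  using assms by blast+

lemma fixed_subfield: "subfield fixed_elements L"
proof (rule L.subfieldI')
  have h: "ring_hom_ring L L u" if "u \<in> Units S" for u
    using elem_hom(4)[OF unit_nonzero[OF that]] .
  show "subring fixed_elements L"
  proof (rule L.subringI)
    show "fixed_elements \<subseteq> carrier L" by blast
    show "\<one>\<^bsub>L\<^esub> \<in> fixed_elements"
      using ring_hom_one[OF ring_hom_ring.homh[OF h]] by blast
  next
    fix a b assume ab: "a \<in> fixed_elements" "b \<in> fixed_elements"
    note ca = fixed_elementsD(1)[OF ab(1)] and cb = fixed_elementsD(1)[OF ab(2)]
    have "u (a \<otimes>\<^bsub>L\<^esub> b) = a \<otimes>\<^bsub>L\<^esub> b" "u (a \<oplus>\<^bsub>L\<^esub> b) = a \<oplus>\<^bsub>L\<^esub> b" if u: "u \<in> Units S" for u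
      using ring_hom_mult[OF ring_hom_ring.homh[OF h[OF u]] ca cb]
        ring_hom_add[OF ring_hom_ring.homh[OF h[OF u]] ca cb]
      unfolding fixed_elementsD(2)[OF ab(1) u] fixed_elementsD(2)[OF ab(2) u] .
    then show "a \<otimes>\<^bsub>L\<^esub> b \<in> fixed_elements" "a \<oplus>\<^bsub>L\<^esub> b \<in> fixed_elements"
      using L.m_closed[OF ca cb] L.a_closed[OF ca cb] by blast+
  next
    fix a assume a: "a \<in> fixed_elements"
    note ca = fixed_elementsD(1)[OF a]
    have "u (\<ominus>\<^bsub>L\<^esub> a) = \<ominus>\<^bsub>L\<^esub> a" if u: "u \<in> Units S" for u
    proof -
      interpret u: ring_hom_ring L L u by (rule h[OF u])
      show ?thesis using u.hom_a_inv[OF ca] unfolding fixed_elementsD(2)[OF a u] .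
    qed
    then show "\<ominus>\<^bsub>L\<^esub> a \<in> fixed_elements" using L.a_inv_closed[OF ca] by blast
  qed
  fix k assume k: "k \<in> fixed_elements - {\<zero>\<^bsub>L\<^esub>}"
  then have kf: "k \<in> fixed_elements" and k0: "k \<noteq> \<zero>\<^bsub>L\<^esub>" by blast+
  note ck = fixed_elementsD(1)[OF kf]
  have ku: "k \<in> Units L" using ck k0 L.field_Units by blast
  note ci = L.Units_inv_closed[OF ku]
  have "u (inv\<^bsub>L\<^esub> k) = inv\<^bsub>L\<^esub> k" if u: "u \<in> Units S" for u
  proof -
    interpret u: ring_hom_ring L L u by (rule h[OF u])
    have "k \<otimes>\<^bsub>L\<^esub> u (inv\<^bsub>L\<^esub> k) = u (k \<otimes>\<^bsub>L\<^esub> inv\<^bsub>L\<^esub> k)"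
      using u.hom_mult[OF ck ci] unfolding fixed_elementsD(2)[OF kf u] by (rule sym)
    also have "\<dots> = \<one>\<^bsub>L\<^esub>" unfolding L.Units_r_inv[OF ku] by (rule u.hom_one)
    finally show ?thesis by (rule L.comm_inv_char[OF ck u.hom_closed[OF ci], symmetric])
  qed
  then show "inv\<^bsub>L\<^esub> k \<in> fixed_elements" using ci by blast
qed

lemma coset_act_eq:
  assumes norm: "\<forall>x \<in> carrier S. x <#\<^bsub>S\<^esub> Units S = Units S #>\<^bsub>S\<^esub> x"
    and x: "x \<in> carrier S - {z}" and l: "l \<in> fixed_elements"
  shows "coset_act (Units S #>\<^bsub>S\<^esub> x) l = x l"
proof -
  have "y l = x l" if "y \<in> Units S #>\<^bsub>S\<^esub> x" for y
  proof -
    have "y \<in> x <#\<^bsub>S\<^esub> Units S" using that norm x by blast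
    then obtain u where u: "u \<in> Units S" "y = x \<otimes>\<^bsub>S\<^esub> u" by (auto simp: l_coset_def)
    have "x \<in> carrier (L.galois_group K)" using x carrier_S by auto
    then have "x \<otimes>\<^bsub>S\<^esub> u \<noteq> z" using unit_mult_nonzero(2)[OF u(1)] by blast
    then have "y l = x (u l)"
      using elem_apply_mult[OF x unit_nonzero[OF u(1)] _ fixed_elementsD(1)[OF l]] u(2) by simp
    then show ?thesis unfolding fixed_elementsD(2)[OF l u(1)] .
  qed
  then have "(\<lambda>y. y l) ` (Units S #>\<^bsub>S\<^esub> x) = (\<lambda>_. x l) ` (Units S #>\<^bsub>S\<^esub> x)"
    by (rule image_cong[OF refl])
  moreover have "Units S #>\<^bsub>S\<^esub> x \<noteq> {}"
    using S.Units_one_closed unfolding r_coset_def by blast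
  ultimately have "(\<lambda>y. y l) ` (Units S #>\<^bsub>S\<^esub> x) = {x l}" by (simp add: image_constant_conv)
  then show ?thesis by (simp add: coset_act_def)
qed

lemma elem_fixed:
  assumes norm: "\<forall>x \<in> carrier S. x <#\<^bsub>S\<^esub> Units S = Units S #>\<^bsub>S\<^esub> x"
    and x: "x \<in> carrier S - {z}" and l: "l \<in> fixed_elements"
  shows "x l \<in> fixed_elements"
proof -
  interpret x: ring_hom_ring L L x by (rule elem_hom(4)[OF x])
  have xG: "x \<in> carrier (L.galois_group K)" using x carrier_S by auto
  have "u (x l) = x l" if u: "u \<in> Units S" for u
  proof -
    have "u \<otimes>\<^bsub>S\<^esub> x \<in> x <#\<^bsub>S\<^esub> Units S" using u norm x by (auto simp: r_coset_def)
    then obtain v where v: "v \<in> Units S" "u \<otimes>\<^bsub>S\<^esub> x = x \<otimes>\<^bsub>S\<^esub> v" by (auto simp: l_coset_def)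
    have "u (x l) = (u \<otimes>\<^bsub>S\<^esub> x) l"
      by (rule elem_apply_mult[OF unit_nonzero[OF u] x unit_mult_nonzero(1)[OF u xG]
            fixed_elementsD(1)[OF l]])
    also have "\<dots> = x (v l)"
      unfolding v(2) by (rule elem_apply_mult[OF x unit_nonzero[OF v(1)]
            unit_mult_nonzero(2)[OF v(1) xG] fixed_elementsD(1)[OF l], symmetric])
    finally show ?thesis unfolding fixed_elementsD(2)[OF l v(1)] .
  qed
  then show ?thesis using x.hom_closed[OF fixed_elementsD(1)[OF l]] by blast
qed

lemma fixed_units_zero_module:
  assumes norm: "\<forall>x \<in> carrier S. x <#\<^bsub>S\<^esub> Units S = Units S #>\<^bsub>S\<^esub> x"
  shows "zero_module (S Mod Units S) {z} (units_of (L\<lparr>carrier := fixed_elements\<rparr>)) coset_act"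
proof -
  let ?P = "L\<lparr>carrier := fixed_elements\<rparr>"
  have P: "field ?P" using L.subfield_iff(2)[OF fixed_subfield] .
  interpret P: field ?P by (rule P)
  have car: "carrier (units_of ?P) = fixed_elements - {\<zero>\<^bsub>L\<^esub>}"
    by (simp add: units_of_carrier P.field_Units)
  have el: "\<exists>x \<in> carrier S - {z}. C = Units S #>\<^bsub>S\<^esub> x"
    if "C \<in> carrier (S Mod Units S) - {{z}}" for C
    using that coset_zero by (auto simp: FactGroup_def RCOSETS_def)
  show ?thesis
  proof (intro zero_module.intro zero_module_axioms.intro)
    show "zero_semigroup (S Mod Units S) {z}" by (rule quotient_zero_semigroup[OF norm])
    show "comm_group (units_of ?P)" by (rule P.units_comm_group)
  next
    fix C a assume C: "C \<in> carrier (S Mod Units S) - {{z}}" and a: "a \<in> carrier (units_of ?P)"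
    obtain x where x: "x \<in> carrier S - {z}" "C = Units S #>\<^bsub>S\<^esub> x" using el[OF C] by blast
    have a': "a \<in> fixed_elements" "a \<in> carrier L - {\<zero>\<^bsub>L\<^esub>}" using a unfolding car by blast+
    show "coset_act C a \<in> carrier (units_of ?P)"
      using elem_fixed[OF norm x(1) a'(1)] elem_nonzero[OF x(1) a'(2)]
      unfolding car x(2) coset_act_eq[OF norm x(1) a'(1)] by blast
  next
    fix C a b assume C: "C \<in> carrier (S Mod Units S) - {{z}}"
      and a: "a \<in> carrier (units_of ?P)" and b: "b \<in> carrier (units_of ?P)"
    obtain x where x: "x \<in> carrier S - {z}" "C = Units S #>\<^bsub>S\<^esub> x" using el[OF C] by blast
    have a': "a \<in> fixed_elements" and b': "b \<in> fixed_elements" using a b unfolding car by blast+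
    have ab: "a \<otimes>\<^bsub>L\<^esub> b \<in> fixed_elements"
      by (rule subringE(6)[OF subfieldE(1)[OF fixed_subfield] a' b'])
    have "x (a \<otimes>\<^bsub>L\<^esub> b) = x a \<otimes>\<^bsub>L\<^esub> x b"
      by (rule ring_hom_mult[OF elem_hom(2)[OF x(1)] fixed_elementsD(1)[OF a'] fixed_elementsD(1)[OF b']])
    then show "coset_act C (a \<otimes>\<^bsub>units_of ?P\<^esub> b) = coset_act C a \<otimes>\<^bsub>units_of ?P\<^esub> coset_act C b"
      using coset_act_eq[OF norm x(1) ab] coset_act_eq[OF norm x(1) a'] coset_act_eq[OF norm x(1) b']
      by (simp add: x(2) units_of_mult)
  next
    fix C D a assume C: "C \<in> carrier (S Mod Units S) - {{z}}"
      and D: "D \<in> carrier (S Mod Units S) - {{z}}"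
      and CD: "C \<otimes>\<^bsub>S Mod Units S\<^esub> D \<noteq> {z}" and a: "a \<in> carrier (units_of ?P)"
    obtain x y where x: "x \<in> carrier S - {z}" "C = Units S #>\<^bsub>S\<^esub> x"
      and y: "y \<in> carrier S - {z}" "D = Units S #>\<^bsub>S\<^esub> y"
      using el[OF C] el[OF D] by blast
    have m: "C \<otimes>\<^bsub>S Mod Units S\<^esub> D = Units S #>\<^bsub>S\<^esub> (x \<otimes>\<^bsub>S\<^esub> y)"
      using x y coset_mult[OF norm, of x y] by (simp add: FactGroup_def)
    then have xy: "x \<otimes>\<^bsub>S\<^esub> y \<in> carrier S - {z}" using CD coset_zero x y by auto
    have a': "a \<in> fixed_elements" using a unfolding car by blast
    have "coset_act C (coset_act D a) = x (y a)"
      unfolding x(2) y(2) coset_act_eq[OF norm y(1) a']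
      by (rule coset_act_eq[OF norm x(1) elem_fixed[OF norm y(1) a']])
    also have "\<dots> = (x \<otimes>\<^bsub>S\<^esub> y) a" 
      using elem_apply_mult[OF x(1) y(1) _ fixed_elementsD(1)[OF a']] xy by blast
    also have "\<dots> = coset_act (C \<otimes>\<^bsub>S Mod Units S\<^esub> D) a"
      unfolding m by (rule coset_act_eq[OF norm xy a', symmetric])
    finally show "coset_act C (coset_act D a) = coset_act (C \<otimes>\<^bsub>S Mod Units S\<^esub> D) a" .
  qed
qed

end

end

theory Submission
  imports Defs
begin

text \<open>
  This is the inflation-restriction argument in degree 2, which survives the passage to 0-cochains
  because a product in \<open>S\<close> cannot become zero by inserting a unit, and units can be moved across
  factors by normality.  The only arithmetic input is Hilbert's Theorem 90 for the finite group
  \<open>U\<close>.  If the inflation of \<open>f\<close> is the coboundary of \<open>g\<close>, then \<open>g\<close> divided by the constant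
  \<open>f(U, U)\<close> is a 1-cocycle on \<open>U\<close>, and multiplying \<open>g\<close> by the coboundary of an element makes
  it constant on \<open>U\<close>, hence on all cosets, with values in \<open>P\<close>.  If \<open>f\<close> splits on \<open>U\<close>, it is changed by
  coboundaries in three steps so that \<open>f(u, v) = 1\<close>, then \<open>f(x, u) = 1\<close>, then \<open>f(u, x) = 1\<close>
  for all units \<open>u, v\<close> and all \<open>x \<noteq> 0\<close>; such a cocycle is constant on pairs of cosets and takes values
  in \<open>P\<close>.
\<close>

section \<open>Subquotients and their induced maps\<close>

text \<open>Cochains live only on tuples with nonzero product, so no cocycle identity may be used
  before its triple is known to be admissible. The normalisations use only triples that contain a
  unit, whose product is nonzero as soon as that of the remaining entries is. A unit factor can
  moreover be cancelled from \<open>x u = x v\<close>, although \<open>S\<close> need not be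
  cancellative, because nonzero products in \<open>S\<close> are products in \<open>G\<close>.

  Cocycles are not assumed to be normalised, hence the constant \<open>c = f(U, U)\<close>: an
  inflated cocycle equals \<open>c\<close> on all pairs of units. As \<open>c\<close> is fixed by
  the units, it is the coboundary of the constant 1-cochain \<open>c\<close>, which is also why
  restriction after inflation is trivial.

  Hilbert 90 enters twice: for injectivity, and again in the last of the three changes, where
  \<open>u \<mapsto> f(u, x)\<close> is a 1-cocycle for each fixed \<open>x\<close>. This dictates
  the order of the changes. The 1-cocycle property rests on \<open>f(u, x w) = f(u, x)\<close>, a
  consequence of \<open>f(x, u) = 1\<close>; and the last change must be constant on cosets and
  trivial on units in order not to destroy what the second one achieved.\<close>

locale subquotient = C: comm_group C for C (structure) and Z B +
  assumes subgroup_Z: "subgroup Z C" and subgroup_B: "subgroup B C" and B_le_Z: "B \<subseteq> Z"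
begin

abbreviation "quot \<equiv> C\<lparr>carrier := Z\<rparr> Mod B"

lemma Z_carrier: "f \<in> Z \<Longrightarrow> f \<in> carrier C"
  using subgroup.subset[OF subgroup_Z] by blast

lemma comm_group_quot: "comm_group quot"
proof -
  interpret Z: comm_group "C\<lparr>carrier := Z\<rparr>"
    by (rule group.group_comm_groupI[OF C.subgroup_imp_group[OF subgroup_Z]])
      (simp add: C.m_comm Z_carrier)
  have "subgroup B (C\<lparr>carrier := Z\<rparr>)"
    by (rule C.subgroup_incl[OF subgroup_B subgroup_Z B_le_Z])
  then show ?thesis by (rule Z.abelian_FactGroup)
qed

lemma carrier_quot: "carrier quot = (\<lambda>f. B #> f) ` Z"
  by (auto simp: FactGroup_def RCOSETS_def r_coset_def)

lemma one_quot: "\<one>\<^bsub>quot\<^esub> = B"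
  by (simp add: FactGroup_def)

lemma mult_quot:
  assumes "f \<in> Z" "g \<in> Z"
  shows "(B #> f) \<otimes>\<^bsub>quot\<^esub> (B #> g) = B #> (f \<otimes> g)"
proof -
  have "B \<lhd> C" by (rule C.subgroup_imp_normal[OF subgroup_B])
  from normal.rcos_sum[OF this, of f g] show ?thesis
    using assms Z_carrier by (simp add: FactGroup_def set_mult_def)
qed

lemma coset_eq_B_iff: "f \<in> Z \<Longrightarrow> B #> f = B \<longleftrightarrow> f \<in> B"
  using C.coset_join1[OF _ Z_carrier subgroup_B] C.coset_join2[OF Z_carrier subgroup_B]
    subgroup.subset[OF subgroup_B] by blast

lemma coset_eqI:
  assumes "f = b \<otimes> g" "b \<in> B" "g \<in> Z"
  shows "B #> f = B #> g"
  using C.coset_mult_assoc[of B b g] C.coset_join2[OF _ subgroup_B, of b] assms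
    subgroup.subset[OF subgroup_B] Z_carrier by auto

end

text \<open>Multiplicativity is required on cocycles only, because a class is represented by
  cocycles and nothing else enters the induced map.\<close>

locale subquotient_map = S1: subquotient C1 Z1 B1 + S2: subquotient C2 Z2 B2
  for C1 :: "('e, 'c) monoid_scheme" and Z1 B1 and C2 :: "('f, 'd) monoid_scheme" and Z2 B2 +
  fixes h
  assumes map_Z: "f \<in> Z1 \<Longrightarrow> h f \<in> Z2" and map_B: "f \<in> B1 \<Longrightarrow> h f \<in> B2"
    and map_mult: "f \<in> Z1 \<Longrightarrow> g \<in> Z1 \<Longrightarrow> h (f \<otimes>\<^bsub>C1\<^esub> g) = h f \<otimes>\<^bsub>C2\<^esub> h g"
begin

text \<open>Since \<open>h (b1 f) = h b1 h f\<close> with \<open>h b1\<close> in \<open>B2\<close>,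
  the set product collapses to a single coset. From here on the induced map is computed on
  representatives.\<close>

lemma induced_map_coset:
  assumes f: "f \<in> Z1"
  shows "induced_map C2 B2 h (B1 #>\<^bsub>C1\<^esub> f) = B2 #>\<^bsub>C2\<^esub> h f"
proof -
  have memI: "b \<otimes>\<^bsub>C2\<^esub> h f \<in> B2 #>\<^bsub>C2\<^esub> h f" if "b \<in> B2" for b
    using that by (auto simp: r_coset_def)
  have B2: "b \<in> carrier C2" if "b \<in> B2" for b
    using that S2.B_le_Z S2.Z_carrier by blast
  have hf: "h f \<in> carrier C2" by (rule S2.Z_carrier[OF map_Z[OF f]])
  show ?thesis
  proof (intro equalityI subsetI)
    fix y assume "y \<in> induced_map C2 B2 h (B1 #>\<^bsub>C1\<^esub> f)"
    then obtain b b1 where b: "b \<in> B2" and b1: "b1 \<in> B1" and y: "y = b \<otimes>\<^bsub>C2\<^esub> h (b1 \<otimes>\<^bsub>C1\<^esub> f)"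
      by (auto simp: induced_map_def set_mult_def r_coset_def)
    have "b1 \<in> Z1" using b1 S1.B_le_Z by blast
    then have "y = (b \<otimes>\<^bsub>C2\<^esub> h b1) \<otimes>\<^bsub>C2\<^esub> h f"
      using S2.C.m_assoc[OF B2[OF b] B2[OF map_B[OF b1]] hf] map_mult f y by simp
    then show "y \<in> B2 #>\<^bsub>C2\<^esub> h f"
      using memI subgroup.m_closed[OF S2.subgroup_B b map_B[OF b1]] by simp
  next
    fix y assume "y \<in> B2 #>\<^bsub>C2\<^esub> h f"
    then obtain b where b: "b \<in> B2" "y = b \<otimes>\<^bsub>C2\<^esub> h f" by (auto simp: r_coset_def)
    have "f \<in> B1 #>\<^bsub>C1\<^esub> f"
      using S1.C.rcos_self[OF S1.Z_carrier[OF f] S1.subgroup_B] .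
    then show "y \<in> induced_map C2 B2 h (B1 #>\<^bsub>C1\<^esub> f)"
      unfolding induced_map_def set_mult_def using b by blast
  qed
qed

lemma induced_map_hom: "group_hom S1.quot S2.quot (induced_map C2 B2 h)"
proof -
  interpret Q1: comm_group S1.quot by (rule S1.comm_group_quot)
  interpret Q2: comm_group S2.quot by (rule S2.comm_group_quot)
  have "induced_map C2 B2 h \<in> hom S1.quot S2.quot"
  proof (rule homI)
    fix c assume "c \<in> carrier S1.quot"
    then show "induced_map C2 B2 h c \<in> carrier S2.quot"
      unfolding S1.carrier_quot S2.carrier_quot using map_Z induced_map_coset by blast
  next
    fix c d assume "c \<in> carrier S1.quot" "d \<in> carrier S1.quot"
    then obtain f g where "f \<in> Z1" "c = B1 #>\<^bsub>C1\<^esub> f" "g \<in> Z1" "d = B1 #>\<^bsub>C1\<^esub> g"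
      unfolding S1.carrier_quot by blast
    then show "induced_map C2 B2 h (c \<otimes>\<^bsub>S1.quot\<^esub> d) =
        induced_map C2 B2 h c \<otimes>\<^bsub>S2.quot\<^esub> induced_map C2 B2 h d"
      using subgroup.m_closed[OF S1.subgroup_Z]
      by (simp only: S1.mult_quot S2.mult_quot induced_map_coset map_Z map_mult)
  qed
  then show ?thesis by unfold_locales
qed

text \<open>With the description of the image below, this turns exactness into statements about
  single cocycles.\<close>

lemma kernel_induced_map:
  "kernel S1.quot S2.quot (induced_map C2 B2 h) = {B1 #>\<^bsub>C1\<^esub> f |f. f \<in> Z1 \<and> h f \<in> B2}"
proof -
  have "induced_map C2 B2 h (B1 #>\<^bsub>C1\<^esub> f) = \<one>\<^bsub>S2.quot\<^esub> \<longleftrightarrow> h f \<in> B2" if "f \<in> Z1" for f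
    using that S2.coset_eq_B_iff[OF map_Z] by (simp only: S2.one_quot induced_map_coset)
  then show ?thesis unfolding kernel_def S1.carrier_quot by blast
qed

lemma image_induced_map:
  "induced_map C2 B2 h ` carrier S1.quot = {B2 #>\<^bsub>C2\<^esub> h f |f. f \<in> Z1}"
  unfolding S1.carrier_quot image_image Setcompr_eq_image by (auto simp: induced_map_coset)

end

section \<open>Cochains of degree at most two\<close>

text \<open>These are the closure properties of admissible tuples that degrees 1 to 3 need. They let
  the 0-cochains of \<open>S\<close>, those of its quotient, and the ordinary cochains of the unit
  group be treated once. Associativity and compatibility of the action are demanded on admissible
  tuples only.\<close>

locale cochain_module = A: comm_group A for A (structure) +
  fixes D :: "nat \<Rightarrow> 's list set" and M :: "('s, 'c) monoid_scheme" and act :: "'s \<Rightarrow> 'a \<Rightarrow> 'a"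
  assumes length_D: "s \<in> D n \<Longrightarrow> length s = n"
    and pairD: "[x, y] \<in> D 2 \<Longrightarrow> [x] \<in> D 1 \<and> [y] \<in> D 1 \<and> [x \<otimes>\<^bsub>M\<^esub> y] \<in> D 1"
    and tripleD: "[x, y, w] \<in> D 3 \<Longrightarrow> [x, y] \<in> D 2 \<and> [y, w] \<in> D 2 \<and>
      [x \<otimes>\<^bsub>M\<^esub> y, w] \<in> D 2 \<and> [x, y \<otimes>\<^bsub>M\<^esub> w] \<in> D 2 \<and>
      x \<otimes>\<^bsub>M\<^esub> y \<otimes>\<^bsub>M\<^esub> w = x \<otimes>\<^bsub>M\<^esub> (y \<otimes>\<^bsub>M\<^esub> w)"
    and act_hom: "[x] \<in> D 1 \<Longrightarrow> act x \<in> hom A A"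
    and act_comp: "[x, y] \<in> D 2 \<Longrightarrow> a \<in> carrier A \<Longrightarrow> act x (act y a) = act (x \<otimes>\<^bsub>M\<^esub> y) a"
begin

abbreviation "Z2 \<equiv> cocycles D M A act 2"
abbreviation "B2 \<equiv> coboundaries D M A act 2"
abbreviation "C2 \<equiv> cochains D A 2"

lemma act_closed: "[x] \<in> D 1 \<Longrightarrow> a \<in> carrier A \<Longrightarrow> act x a \<in> carrier A"
  using act_hom by (rule hom_in_carrier)

lemma act_mult: "[x] \<in> D 1 \<Longrightarrow> a \<in> carrier A \<Longrightarrow> b \<in> carrier A \<Longrightarrow>
    act x (a \<otimes> b) = act x a \<otimes> act x b"
  using act_hom by (rule hom_mult)

lemma act_inv: "[x] \<in> D 1 \<Longrightarrow> a \<in> carrier A \<Longrightarrow> act x (inv a) = inv (act x a)"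
  using group_hom.hom_inv[OF group_hom.intro[OF A.is_group A.is_group]] act_hom
  by (simp add: group_hom_axioms_def)

lemma act_one: "[x] \<in> D 1 \<Longrightarrow> act x \<one> = \<one>"
  using group_hom.hom_one[OF group_hom.intro[OF A.is_group A.is_group]] act_hom
  by (simp add: group_hom_axioms_def)

lemma D2_cases: "s \<in> D 2 \<Longrightarrow> \<exists>x y. s = [x, y]"
  using length_D[of s 2] by (auto simp: length_Suc_conv numeral_2_eq_2)

lemma D3_cases: "s \<in> D 3 \<Longrightarrow> \<exists>x y w. s = [x, y, w]"
  using length_D[of s 3] by (auto simp: length_Suc_conv numeral_3_eq_3)

lemma D1_cases: "s \<in> D 1 \<Longrightarrow> \<exists>x. s = [x]"
  using length_D[of s 1] by (auto simp: length_Suc_conv)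

lemma cochainsI: "(\<And>s. s \<in> D n \<Longrightarrow> f s \<in> carrier A) \<Longrightarrow> f \<in> extensional (D n) \<Longrightarrow>
    f \<in> carrier (cochains D A n)"
  by (auto simp: cochains_def PiE_iff)

lemma cochains_apply: "f \<in> carrier (cochains D A n) \<Longrightarrow> s \<in> D n \<Longrightarrow> f s \<in> carrier A"
  by (auto simp: cochains_def)

lemma cochains_eqI: "f \<in> extensional (D n) \<Longrightarrow> g \<in> extensional (D n) \<Longrightarrow>
    (\<And>s. s \<in> D n \<Longrightarrow> f s = g s) \<Longrightarrow> f = g"
  by (rule extensionalityI)

lemma comm_group_cochains: "comm_group (cochains D A n)"
proof -
  interpret group "cochains D A n" by (simp add: cochains_def A.is_group)
  show ?thesis
    by (rule group_comm_groupI)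
      (auto simp: cochains_def PiE_iff A.m_comm intro!: restrict_ext)
qed

lemma coboundary_1:
  assumes "[x, y] \<in> D 2" "f \<in> carrier (cochains D A 1)"
  shows "coboundary D M A act 1 f [x, y] = act x (f [y]) \<otimes> inv f [x \<otimes>\<^bsub>M\<^esub> y] \<otimes> f [x]"
proof -
  note cl = pairD[OF assms(1)] cochains_apply[OF assms(2)] act_closed
  have "coboundary D M A act 1 f [x, y] =
      act x (f [y]) \<otimes> (\<Otimes>i\<in>{1}. f (contract M i [x, y]) [^] ((-1) ^ i :: int)) \<otimes>
      f [x] [^] ((-1) ^ 2 :: int)"
    using assms(1) by (simp add: coboundary_def numeral_2_eq_2)
  then show ?thesis using cl by (simp add: contract_def A.int_pow_neg_int A.int_pow_1 A.int_pow_neg)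
qed

lemma tripleD1: "[x, y, w] \<in> D 3 \<Longrightarrow> [x] \<in> D 1 \<and> [y] \<in> D 1 \<and> [w] \<in> D 1 \<and>
    [x \<otimes>\<^bsub>M\<^esub> y] \<in> D 1 \<and> [y \<otimes>\<^bsub>M\<^esub> w] \<in> D 1 \<and> [x \<otimes>\<^bsub>M\<^esub> (y \<otimes>\<^bsub>M\<^esub> w)] \<in> D 1"
  using tripleD[of x y w] pairD[of x y] pairD[of y w] pairD[of x "y \<otimes>\<^bsub>M\<^esub> w"] by blast

lemma triple_closed:
  assumes "[x, y, w] \<in> D 3" "f \<in> carrier (cochains D A 2)"
  shows "f [y, w] \<in> carrier A" "act x (f [y, w]) \<in> carrier A"
    "f [x, y \<otimes>\<^bsub>M\<^esub> w] \<in> carrier A" "f [x \<otimes>\<^bsub>M\<^esub> y, w] \<in> carrier A" "f [x, y] \<in> carrier A"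
  using tripleD[OF assms(1)] tripleD1[OF assms(1)] cochains_apply[OF assms(2)] act_closed
  by blast+

lemma coboundary_2:
  assumes "[x, y, w] \<in> D 3" "f \<in> carrier (cochains D A 2)"
  shows "coboundary D M A act 2 f [x, y, w] =
    act x (f [y, w]) \<otimes> (inv f [x \<otimes>\<^bsub>M\<^esub> y, w] \<otimes> f [x, y \<otimes>\<^bsub>M\<^esub> w]) \<otimes> inv f [x, y]"
proof -
  note cl = triple_closed[OF assms]
  have "{1..2::nat} = {1, 2}" by auto
  then have "coboundary D M A act 2 f [x, y, w] =
      act x (f [y, w]) \<otimes> (\<Otimes>i\<in>{1, 2}. f (contract M i [x, y, w]) [^] ((-1) ^ i :: int)) \<otimes>
      f [x, y] [^] ((-1) ^ 3 :: int)"
    using assms(1) by (simp add: coboundary_def numeral_3_eq_3 numeral_2_eq_2)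
  then show ?thesis using cl by (simp add: contract_def A.int_pow_neg A.int_pow_1)
qed

text \<open>The inverses coming from the signs are moved across the equation, leaving an identity
  between products that commutativity and associativity can rearrange.\<close>

lemma cocycle_iff:
  "f \<in> Z2 \<longleftrightarrow> f \<in> carrier C2 \<and>
    (\<forall>x y w. [x, y, w] \<in> D 3 \<longrightarrow>
      act x (f [y, w]) \<otimes> f [x, y \<otimes>\<^bsub>M\<^esub> w] = f [x \<otimes>\<^bsub>M\<^esub> y, w] \<otimes> f [x, y])"
proof (cases "f \<in> carrier C2")
  case True
  have eq: "coboundary D M A act 2 f [x, y, w] = \<one> \<longleftrightarrow>
      act x (f [y, w]) \<otimes> f [x, y \<otimes>\<^bsub>M\<^esub> w] = f [x \<otimes>\<^bsub>M\<^esub> y, w] \<otimes> f [x, y]"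
    if t: "[x, y, w] \<in> D 3" for x y w
  proof -
    note cl = triple_closed[OF t True]
    have "coboundary D M A act 2 f [x, y, w] =
        (act x (f [y, w]) \<otimes> f [x, y \<otimes>\<^bsub>M\<^esub> w]) \<otimes> inv (f [x \<otimes>\<^bsub>M\<^esub> y, w] \<otimes> f [x, y])"
      using cl unfolding coboundary_2[OF t True] by (simp add: A.inv_mult A.m_ac)
    then show ?thesis using cl A.inv_solve_right'[of \<one>] by (auto simp: A.inv_solve_right')
  qed
  have "coboundary D M A act 2 f \<in> extensional (D 3)"
    by (simp add: coboundary_def numeral_3_eq_3 numeral_2_eq_2)
  then have "coboundary D M A act 2 f = \<one>\<^bsub>cochains D A (Suc 2)\<^esub> \<longleftrightarrow>
      (\<forall>s\<in>D 3. coboundary D M A act 2 f s = \<one>)"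
    by (auto simp: cochains_def numeral_3_eq_3 numeral_2_eq_2 intro!: extensionalityI)
  also have "\<dots> \<longleftrightarrow> (\<forall>x y w. [x, y, w] \<in> D 3 \<longrightarrow> coboundary D M A act 2 f [x, y, w] = \<one>)"
    using D3_cases by blast
  finally show ?thesis using True eq by (simp add: cocycles_def kernel_def)
qed (simp add: cocycles_def kernel_def)

text \<open>The 1-cochain is replaced by a function \<open>k\<close> of elements with arbitrary
  values outside \<open>D 1\<close>, so that later witnesses need not be extensional functions of
  singleton lists. As for cocycles, inverses are cleared.\<close>

lemma coboundary_iff:
  "f \<in> B2 \<longleftrightarrow> f \<in> carrier C2 \<and> (\<exists>k. (\<forall>x. [x] \<in> D 1 \<longrightarrow> k x \<in> carrier A) \<and>
    (\<forall>x y. [x, y] \<in> D 2 \<longrightarrow> f [x, y] \<otimes> k (x \<otimes>\<^bsub>M\<^esub> y) = act x (k y) \<otimes> k x))"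
    (is "_ \<longleftrightarrow> _ \<and> (\<exists>k. ?P k \<and> ?Q k)")
proof -
  have ext: "coboundary D M A act 1 g \<in> extensional (D 2)" for g
    by (simp add: coboundary_def numeral_2_eq_2)
  have cob: "coboundary D M A act 1 g [x, y] \<otimes> g [x \<otimes>\<^bsub>M\<^esub> y] = act x (g [y]) \<otimes> g [x]"
    "coboundary D M A act 1 g [x, y] \<in> carrier A"
    if t: "[x, y] \<in> D 2" and g: "g \<in> carrier (cochains D A 1)" for g x y
  proof -
    have cl: "act x (g [y]) \<in> carrier A" "g [x \<otimes>\<^bsub>M\<^esub> y] \<in> carrier A" "g [x] \<in> carrier A"
      using pairD[OF t] cochains_apply[OF g] act_closed by auto
    show "coboundary D M A act 1 g [x, y] \<otimes> g [x \<otimes>\<^bsub>M\<^esub> y] = act x (g [y]) \<otimes> g [x]"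
      using cl unfolding coboundary_1[OF t g] by (simp add: A.m_ac)
    show "coboundary D M A act 1 g [x, y] \<in> carrier A"
      using cl unfolding coboundary_1[OF t g] by simp
  qed
  have B2: "B2 = coboundary D M A act 1 ` carrier (cochains D A 1)"
    by (simp add: coboundaries_def numeral_2_eq_2)
  show ?thesis
  proof
    assume "f \<in> B2"
    then obtain g where g: "g \<in> carrier (cochains D A 1)" and f: "f = coboundary D M A act 1 g"
      by (auto simp: B2)
    have "f \<in> carrier C2"
      unfolding f using cob(2)[OF _ g] D2_cases by (intro cochainsI ext) blast
    then show "f \<in> carrier C2 \<and> (\<exists>k. ?P k \<and> ?Q k)" unfolding f
      by (intro conjI exI[of _ "\<lambda>x. g [x]"] allI impI cochains_apply[OF g] cob(1)[OF _ g])
  next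
    assume r: "f \<in> carrier C2 \<and> (\<exists>k. ?P k \<and> ?Q k)"
    then obtain k where k: "?P k" "?Q k" by blast
    let ?g = "\<lambda>s\<in>D 1. k (hd s)"
    have g: "?g \<in> carrier (cochains D A 1)"
    proof (rule cochainsI)
      fix s assume s: "s \<in> D 1"
      then show "?g s \<in> carrier A" using D1_cases[OF s] k(1) by auto
    qed simp
    have "f s = coboundary D M A act 1 ?g s" if s: "s \<in> D 2" for s
    proof -
      obtain x y where xy: "s = [x, y]" using D2_cases[OF s] by blast
      have cl: "k (x \<otimes>\<^bsub>M\<^esub> y) \<in> carrier A" "f [x, y] \<in> carrier A"
        using pairD s k(1) r cochains_apply[of f 2] unfolding xy by auto
      have "f [x, y] \<otimes> k (x \<otimes>\<^bsub>M\<^esub> y) = coboundary D M A act 1 ?g [x, y] \<otimes> k (x \<otimes>\<^bsub>M\<^esub> y)"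
        using cob(1)[OF _ g, of x y] k(2) s pairD[of x y] unfolding xy by simp
      then show ?thesis using cl cob(2)[OF _ g, of x y] s unfolding xy by simp
    qed
    then have "f = coboundary D M A act 1 ?g"
      using r ext by (intro cochains_eqI[of _ 2]) (auto simp: cochains_def PiE_iff)
    then show "f \<in> B2" using g by (simp add: B2)
  qed
qed

section \<open>2-cocycles and 2-coboundaries as subgroups\<close>

lemma cochains_mult: "s \<in> D n \<Longrightarrow> (f \<otimes>\<^bsub>cochains D A n\<^esub> g) s = f s \<otimes> g s"
  by (simp add: cochains_def)

lemma cochains_one: "s \<in> D n \<Longrightarrow> \<one>\<^bsub>cochains D A n\<^esub> s = \<one>"
  by (simp add: cochains_def)

lemma cochains_inv:
  "f \<in> carrier (cochains D A n) \<Longrightarrow> s \<in> D n \<Longrightarrow> (inv\<^bsub>cochains D A n\<^esub> f) s = inv (f s)"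
  by (simp add: cochains_def A.is_group)

lemma subgroup_cocycles: "subgroup Z2 C2"
proof -
  interpret C: comm_group C2 by (rule comm_group_cochains)
  show ?thesis
  proof (rule C.subgroupI)
    show "Z2 \<subseteq> carrier C2" by (auto simp: cocycle_iff)
    have "\<one>\<^bsub>C2\<^esub> \<in> Z2"
      using tripleD pairD by (auto simp: cocycle_iff cochains_one act_one dest!: tripleD)
    then show "Z2 \<noteq> {}" by blast
  next
    fix f assume f: "f \<in> Z2"
    then have fc: "f \<in> carrier C2" by (simp add: cocycle_iff)
    have "act x (inv f [y, w]) \<otimes> inv f [x, y \<otimes>\<^bsub>M\<^esub> w] = inv f [x \<otimes>\<^bsub>M\<^esub> y, w] \<otimes> inv f [x, y]"
      if t: "[x, y, w] \<in> D 3" for x y w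
    proof -
      note cl = triple_closed[OF t fc] tripleD1[OF t]
      have "inv (act x (f [y, w]) \<otimes> f [x, y \<otimes>\<^bsub>M\<^esub> w]) = inv (f [x \<otimes>\<^bsub>M\<^esub> y, w] \<otimes> f [x, y])"
        using f t by (simp add: cocycle_iff)
      then show ?thesis using cl by (simp add: A.inv_mult act_inv)
    qed
    then show "inv\<^bsub>C2\<^esub> f \<in> Z2" using fc tripleD by (simp add: cocycle_iff cochains_inv)
  next
    fix f g assume f: "f \<in> Z2" and g: "g \<in> Z2"
    then have fc: "f \<in> carrier C2" and gc: "g \<in> carrier C2" by (simp_all add: cocycle_iff)
    have "act x (f [y, w] \<otimes> g [y, w]) \<otimes> (f [x, y \<otimes>\<^bsub>M\<^esub> w] \<otimes> g [x, y \<otimes>\<^bsub>M\<^esub> w]) =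
        (f [x \<otimes>\<^bsub>M\<^esub> y, w] \<otimes> g [x \<otimes>\<^bsub>M\<^esub> y, w]) \<otimes> (f [x, y] \<otimes> g [x, y])"
      if t: "[x, y, w] \<in> D 3" for x y w
    proof -
      note cl = triple_closed[OF t fc] triple_closed[OF t gc] tripleD1[OF t]
      have "(act x (f [y, w]) \<otimes> f [x, y \<otimes>\<^bsub>M\<^esub> w]) \<otimes> (act x (g [y, w]) \<otimes> g [x, y \<otimes>\<^bsub>M\<^esub> w]) =
          (f [x \<otimes>\<^bsub>M\<^esub> y, w] \<otimes> f [x, y]) \<otimes> (g [x \<otimes>\<^bsub>M\<^esub> y, w] \<otimes> g [x, y])"
        using f g t by (simp add: cocycle_iff)
      then show ?thesis using cl by (simp add: act_mult A.m_ac)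
    qed
    then show "f \<otimes>\<^bsub>C2\<^esub> g \<in> Z2" using fc gc tripleD by (simp add: cocycle_iff cochains_mult)
  qed
qed

lemma coboundaries_le_cocycles: "B2 \<subseteq> Z2"
proof
  fix f assume "f \<in> B2"
  then obtain k where f: "f \<in> carrier C2" and k: "\<And>x. [x] \<in> D 1 \<Longrightarrow> k x \<in> carrier A"
    and fk: "\<And>x y. [x, y] \<in> D 2 \<Longrightarrow> f [x, y] \<otimes> k (x \<otimes>\<^bsub>M\<^esub> y) = act x (k y) \<otimes> k x"
    unfolding coboundary_iff by blast
  have "act x (f [y, w]) \<otimes> f [x, y \<otimes>\<^bsub>M\<^esub> w] = f [x \<otimes>\<^bsub>M\<^esub> y, w] \<otimes> f [x, y]"
    if t: "[x, y, w] \<in> D 3" for x y w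
  proof -
    note D = tripleD[OF t]
    have cl: "[x] \<in> D 1" "[y] \<in> D 1" "[x \<otimes>\<^bsub>M\<^esub> y] \<in> D 1"
      using tripleD1[OF t] by blast+
    have kl: "k x \<in> carrier A" "k y \<in> carrier A" "k w \<in> carrier A" "k (x \<otimes>\<^bsub>M\<^esub> y) \<in> carrier A"
      "k (y \<otimes>\<^bsub>M\<^esub> w) \<in> carrier A" "k (x \<otimes>\<^bsub>M\<^esub> (y \<otimes>\<^bsub>M\<^esub> w)) \<in> carrier A"
      using tripleD1[OF t] k by blast+
    note al = triple_closed[OF t f] act_closed[OF cl(1)] act_closed[OF cl(2)] act_closed[OF cl(3)]
    \<comment> \<open>\<open>?T\<close> collects the values of \<open>k\<close> that complete the
      four values of \<open>f\<close> to left sides of \<open>e1\<close> to \<open>e4\<close>. Both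
      sides of the cocycle identity are multiplied by it, and it is cancelled at the end.\<close>
    let ?T = "act x (k (y \<otimes>\<^bsub>M\<^esub> w)) \<otimes> k (x \<otimes>\<^bsub>M\<^esub> (y \<otimes>\<^bsub>M\<^esub> w)) \<otimes> k (x \<otimes>\<^bsub>M\<^esub> y)"
    have e1: "act x (f [y, w]) \<otimes> act x (k (y \<otimes>\<^bsub>M\<^esub> w)) = act (x \<otimes>\<^bsub>M\<^esub> y) (k w) \<otimes> act x (k y)"
      using arg_cong[OF fk[of y w], of "act x"] D cl kl al by (simp add: act_mult act_comp)
    have e2: "f [x, y \<otimes>\<^bsub>M\<^esub> w] \<otimes> k (x \<otimes>\<^bsub>M\<^esub> (y \<otimes>\<^bsub>M\<^esub> w)) = act x (k (y \<otimes>\<^bsub>M\<^esub> w)) \<otimes> k x"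
      using fk[of x "y \<otimes>\<^bsub>M\<^esub> w"] D by simp
    have e3: "f [x \<otimes>\<^bsub>M\<^esub> y, w] \<otimes> k (x \<otimes>\<^bsub>M\<^esub> (y \<otimes>\<^bsub>M\<^esub> w)) = act (x \<otimes>\<^bsub>M\<^esub> y) (k w) \<otimes> k (x \<otimes>\<^bsub>M\<^esub> y)"
      using fk[of "x \<otimes>\<^bsub>M\<^esub> y" w] D by simp
    have e4: "f [x, y] \<otimes> k (x \<otimes>\<^bsub>M\<^esub> y) = act x (k y) \<otimes> k x" using fk[of x y] D by simp
    have "(act x (f [y, w]) \<otimes> f [x, y \<otimes>\<^bsub>M\<^esub> w]) \<otimes> ?T =
        (act x (f [y, w]) \<otimes> act x (k (y \<otimes>\<^bsub>M\<^esub> w))) \<otimes>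
        (f [x, y \<otimes>\<^bsub>M\<^esub> w] \<otimes> k (x \<otimes>\<^bsub>M\<^esub> (y \<otimes>\<^bsub>M\<^esub> w))) \<otimes> k (x \<otimes>\<^bsub>M\<^esub> y)"
      using cl kl al by (simp add: A.m_ac)
    also have "\<dots> = (f [x \<otimes>\<^bsub>M\<^esub> y, w] \<otimes> k (x \<otimes>\<^bsub>M\<^esub> (y \<otimes>\<^bsub>M\<^esub> w))) \<otimes>
        (f [x, y] \<otimes> k (x \<otimes>\<^bsub>M\<^esub> y)) \<otimes> act x (k (y \<otimes>\<^bsub>M\<^esub> w))"
      unfolding e1 e2 e3 e4 using cl kl al by (simp add: A.m_ac)
    also have "\<dots> = (f [x \<otimes>\<^bsub>M\<^esub> y, w] \<otimes> f [x, y]) \<otimes> ?T"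
      using cl kl al by (simp add: A.m_ac)
    finally show ?thesis using cl kl al by simp
  qed
  then show "f \<in> Z2" using f by (simp add: cocycle_iff)
qed

lemma subgroup_coboundaries: "subgroup B2 C2"
proof -
  interpret C: comm_group C2 by (rule comm_group_cochains)
  show ?thesis
  proof (rule C.subgroupI)
    show "B2 \<subseteq> carrier C2" by (auto simp: coboundary_iff)
    have "\<one>\<^bsub>C2\<^esub> \<in> B2" unfolding coboundary_iff
      by (intro conjI exI[of _ "\<lambda>_. \<one>"]) (use pairD act_one in \<open>auto simp: cochains_one\<close>)
    then show "B2 \<noteq> {}" by blast
  next
    fix f assume "f \<in> B2"
    then obtain k where f: "f \<in> carrier C2" and k: "\<And>x. [x] \<in> D 1 \<Longrightarrow> k x \<in> carrier A"
      and fk: "\<And>x y. [x, y] \<in> D 2 \<Longrightarrow> f [x, y] \<otimes> k (x \<otimes>\<^bsub>M\<^esub> y) = act x (k y) \<otimes> k x"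
      unfolding coboundary_iff by blast
    have "inv f [x, y] \<otimes> inv k (x \<otimes>\<^bsub>M\<^esub> y) = act x (inv k y) \<otimes> inv k x" if t: "[x, y] \<in> D 2" for x y
      using arg_cong[OF fk[OF t], of "\<lambda>a. inv a"] pairD[OF t] k cochains_apply[OF f t]
      by (simp add: A.inv_mult act_inv act_closed)
    then show "inv\<^bsub>C2\<^esub> f \<in> B2" unfolding coboundary_iff
      by (intro conjI exI[of _ "\<lambda>x. inv k x"]) (use f k in \<open>auto simp: cochains_inv\<close>)
  next
    fix f g assume "f \<in> B2" "g \<in> B2"
    then obtain k l where f: "f \<in> carrier C2" and k: "\<And>x. [x] \<in> D 1 \<Longrightarrow> k x \<in> carrier A"
      and fk: "\<And>x y. [x, y] \<in> D 2 \<Longrightarrow> f [x, y] \<otimes> k (x \<otimes>\<^bsub>M\<^esub> y) = act x (k y) \<otimes> k x"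
      and g: "g \<in> carrier C2" and l: "\<And>x. [x] \<in> D 1 \<Longrightarrow> l x \<in> carrier A"
      and gl: "\<And>x y. [x, y] \<in> D 2 \<Longrightarrow> g [x, y] \<otimes> l (x \<otimes>\<^bsub>M\<^esub> y) = act x (l y) \<otimes> l x"
      unfolding coboundary_iff by blast
    have "f [x, y] \<otimes> g [x, y] \<otimes> (k (x \<otimes>\<^bsub>M\<^esub> y) \<otimes> l (x \<otimes>\<^bsub>M\<^esub> y)) =
        act x (k y \<otimes> l y) \<otimes> (k x \<otimes> l x)" if t: "[x, y] \<in> D 2" for x y
    proof -
      have "(f [x, y] \<otimes> k (x \<otimes>\<^bsub>M\<^esub> y)) \<otimes> (g [x, y] \<otimes> l (x \<otimes>\<^bsub>M\<^esub> y)) =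
          (act x (k y) \<otimes> k x) \<otimes> (act x (l y) \<otimes> l x)"
        unfolding fk[OF t] gl[OF t] ..
      then show ?thesis
        using pairD[OF t] k l cochains_apply[OF f t] cochains_apply[OF g t]
        by (simp add: act_mult act_closed A.m_ac)
    qed
    then show "f \<otimes>\<^bsub>C2\<^esub> g \<in> B2" unfolding coboundary_iff
      by (intro conjI exI[of _ "\<lambda>x. k x \<otimes> l x"]) (use f g k l in \<open>auto simp: cochains_mult\<close>)
  qed
qed

lemma subquotient: "subquotient C2 Z2 B2"
  by (intro subquotient.intro subquotient_axioms.intro comm_group_cochains subgroup_cocycles
      subgroup_coboundaries coboundaries_le_cocycles)

text \<open>The last equation says that \<open>f'\<close> is \<open>f\<close> divided by the
  coboundary of \<open>k\<close>, again without inverses. Every normalisation below is an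
  application with a suitable \<open>k\<close>.\<close>

lemma modify_by_coboundary:
  assumes f: "f \<in> Z2" and k: "\<And>x. [x] \<in> D 1 \<Longrightarrow> k x \<in> carrier A"
  obtains f' where "f' \<in> Z2" "B2 #>\<^bsub>C2\<^esub> f = B2 #>\<^bsub>C2\<^esub> f'"
    "\<And>x y. [x, y] \<in> D 2 \<Longrightarrow> f' [x, y] \<otimes> (act x (k y) \<otimes> k x) = f [x, y] \<otimes> k (x \<otimes>\<^bsub>M\<^esub> y)"
proof -
  interpret C: comm_group C2 by (rule comm_group_cochains)
  interpret Q: subquotient C2 Z2 B2 by (rule subquotient)
  let ?b = "\<lambda>s\<in>D 2. act (hd s) (k (s ! 1)) \<otimes> inv k (hd s \<otimes>\<^bsub>M\<^esub> s ! 1) \<otimes> k (hd s)"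
  let ?f = "inv\<^bsub>C2\<^esub> ?b \<otimes>\<^bsub>C2\<^esub> f"
  have bc: "?b \<in> carrier C2"
  proof (rule cochainsI)
    fix s assume s: "s \<in> D 2"
    obtain x y where xy: "s = [x, y]" using D2_cases[OF s] by blast
    show "?b s \<in> carrier A" using s pairD[of x y] k act_closed by (simp add: xy)
  qed simp
  have bk: "?b [x, y] \<otimes> k (x \<otimes>\<^bsub>M\<^esub> y) = act x (k y) \<otimes> k x" if "[x, y] \<in> D 2" for x y
    using that pairD[OF that] k act_closed by (simp add: A.m_ac)
  have b: "?b \<in> B2" unfolding coboundary_iff
    by (intro conjI exI[of _ k]) (use bc bk k in auto)
  have ib: "inv\<^bsub>C2\<^esub> ?b \<in> B2" by (rule subgroup.m_inv_closed[OF subgroup_coboundaries b])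
  have fc: "f \<in> carrier C2" using f by (simp add: cocycle_iff)
  have f': "?f \<in> Z2"
    using subgroup.m_closed[OF subgroup_cocycles _ f] ib coboundaries_le_cocycles by blast
  show ?thesis
  proof (rule that[OF f'])
    show "B2 #>\<^bsub>C2\<^esub> f = B2 #>\<^bsub>C2\<^esub> ?f" by (rule Q.coset_eqI[OF refl ib f, symmetric])
    fix x y assume t: "[x, y] \<in> D 2"
    have cl: "?b [x, y] \<in> carrier A" "f [x, y] \<in> carrier A"
      using cochains_apply[OF bc t] cochains_apply[OF fc t] .
    have "?f [x, y] = inv (?b [x, y]) \<otimes> f [x, y]"
      by (simp only: cochains_mult[OF t] cochains_inv[OF bc t])
    moreover have "inv (?b [x, y]) \<otimes> f [x, y] \<otimes> (?b [x, y] \<otimes> k (x \<otimes>\<^bsub>M\<^esub> y)) = f [x, y] \<otimes> k (x \<otimes>\<^bsub>M\<^esub> y)"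
    proof -
      have "inv c \<otimes> d \<otimes> (c \<otimes> e) = d \<otimes> e" if "c \<in> carrier A" "d \<in> carrier A" "e \<in> carrier A" for c d e
        using that by (metis A.inv_closed A.m_assoc A.m_closed A.m_comm A.r_inv A.r_one)
      from this[OF cl k] show ?thesis using pairD[OF t] by blast
    qed
    ultimately show "?f [x, y] \<otimes> (act x (k y) \<otimes> k x) = f [x, y] \<otimes> k (x \<otimes>\<^bsub>M\<^esub> y)"
      unfolding bk[OF t] by simp
  qed
qed

end

section \<open>0-cochains of a semigroup and cochains of a group as instances\<close>

lemma zero_tuples_1: "[x] \<in> zero_tuples S z (Suc 0) \<longleftrightarrow> x \<in> carrier S - {z}"
  by (auto simp: zero_tuples_def)

lemma zero_tuples_2:
  "[x, y] \<in> zero_tuples S z 2 \<longleftrightarrow> x \<in> carrier S \<and> y \<in> carrier S \<and> x \<otimes>\<^bsub>S\<^esub> y \<noteq> z"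
  by (auto simp: zero_tuples_def)

lemma zero_tuples_3:
  "[x, y, w] \<in> zero_tuples S z 3 \<longleftrightarrow>
    x \<in> carrier S \<and> y \<in> carrier S \<and> w \<in> carrier S \<and> x \<otimes>\<^bsub>S\<^esub> y \<otimes>\<^bsub>S\<^esub> w \<noteq> z"
  by (auto simp: zero_tuples_def)

text \<open>A factor of a nonzero product is nonzero, so all faces of an admissible tuple are
  admissible.\<close>

lemma (in zero_module) cochain_module: "cochain_module A (zero_tuples S z) S act"
proof (intro cochain_module.intro cochain_module_axioms.intro)
  show "comm_group A" by (rule A.comm_group_axioms)
next
  fix s n assume "s \<in> zero_tuples S z n"
  then show "length s = n" by (simp add: zero_tuples_def)
next
  fix x y assume "[x, y] \<in> zero_tuples S z 2"
  then show "[x] \<in> zero_tuples S z 1 \<and> [y] \<in> zero_tuples S z 1 \<and> [x \<otimes> y] \<in> zero_tuples S z 1"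
    using zs_closed zs_zero_left zs_zero_right by (auto simp: zero_tuples_1 zero_tuples_2)
next
  fix x y w assume "[x, y, w] \<in> zero_tuples S z 3"
  then have "x \<in> carrier S" "y \<in> carrier S" "w \<in> carrier S" "x \<otimes> y \<otimes> w \<noteq> z"
    by (simp_all add: zero_tuples_3)
  moreover from this have "x \<otimes> (y \<otimes> w) \<noteq> z" "x \<otimes> y \<noteq> z" "y \<otimes> w \<noteq> z"
    using zs_assoc zs_zero_left zs_zero_right by auto
  ultimately show "[x, y] \<in> zero_tuples S z 2 \<and> [y, w] \<in> zero_tuples S z 2 \<and>
      [x \<otimes> y, w] \<in> zero_tuples S z 2 \<and> [x, y \<otimes> w] \<in> zero_tuples S z 2 \<and>
      x \<otimes> y \<otimes> w = x \<otimes> (y \<otimes> w)"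
    using zs_closed zs_assoc by (simp add: zero_tuples_2)
next
  fix x assume "[x] \<in> zero_tuples S z 1"
  then show "act x \<in> hom A A"
    using act_closed act_mult by (intro homI) (simp_all add: zero_tuples_1)
next
  fix x y a assume "[x, y] \<in> zero_tuples S z 2" and a: "a \<in> carrier A"
  then have "x \<in> carrier S" "y \<in> carrier S" "x \<otimes> y \<noteq> z" by (simp_all add: zero_tuples_2)
  then show "act x (act y a) = act (x \<otimes> y) a"
    using zs_zero_left zs_zero_right by (intro act_act a) auto
qed

lemma all_tuples_1: "[x] \<in> all_tuples V (Suc 0) \<longleftrightarrow> x \<in> carrier V"
  by (auto simp: all_tuples_def)

lemma all_tuples_2: "[x, y] \<in> all_tuples V 2 \<longleftrightarrow> x \<in> carrier V \<and> y \<in> carrier V"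
  by (auto simp: all_tuples_def)

lemma all_tuples_3:
  "[x, y, w] \<in> all_tuples V 3 \<longleftrightarrow> x \<in> carrier V \<and> y \<in> carrier V \<and> w \<in> carrier V"
  by (auto simp: all_tuples_def)

lemma cochain_module_all_tuples:
  assumes "monoid V" and A: "comm_group A"
    and hom: "\<And>v. v \<in> carrier V \<Longrightarrow> act v \<in> hom A A"
    and comp: "\<And>u v a. u \<in> carrier V \<Longrightarrow> v \<in> carrier V \<Longrightarrow> a \<in> carrier A \<Longrightarrow>
      act u (act v a) = act (u \<otimes>\<^bsub>V\<^esub> v) a"
  shows "cochain_module A (all_tuples V) V act"
proof -
  interpret V: monoid V by fact
  show ?thesis
    by (intro cochain_module.intro cochain_module_axioms.intro A)
      (auto simp: all_tuples_1 all_tuples_2 all_tuples_3 V.m_assoc hom comp, simp add: all_tuples_def)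
qed


section \<open>Inflation and restriction for modifications\<close>

text \<open>Fields are abstracted away: the coefficients form any 0-module, and the quotient acts on
  its \<open>U\<close>-fixed elements. The assumption \<open>hilbert90\<close> says that every
  1-cocycle of the units has the form \<open>u \<mapsto> u b / b\<close>, i.e. that the first
  cohomology group of the units in \<open>A\<close> is trivial.\<close>

locale modification_module = modification G S z + M: zero_module S z A act +
  Q: zero_module "S Mod Units S" "{z}" "A\<lparr>carrier := {a \<in> carrier A. \<forall>u \<in> Units S. act u a = a}\<rparr>" qact
  for G :: "('g, 'b) monoid_scheme" and S :: "('g, 'c) monoid_scheme" and z
    and A :: "('a, 'd) monoid_scheme" (structure) and act and qact +
  assumes norm: "\<forall>x \<in> carrier S. x <#\<^bsub>S\<^esub> Units S = Units S #>\<^bsub>S\<^esub> x"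
    and qact_coset: "x \<in> carrier S - {z} \<Longrightarrow> a \<in> carrier A \<Longrightarrow> (\<And>u. u \<in> Units S \<Longrightarrow> act u a = a) \<Longrightarrow>
      qact (Units S #>\<^bsub>S\<^esub> x) a = act x a"
    and hilbert90: "(\<And>u. u \<in> Units S \<Longrightarrow> c u \<in> carrier A) \<Longrightarrow>
      (\<And>u v. u \<in> Units S \<Longrightarrow> v \<in> Units S \<Longrightarrow> c (u \<otimes>\<^bsub>S\<^esub> v) = act u (c v) \<otimes> c u) \<Longrightarrow>
      \<exists>b \<in> carrier A. \<forall>u \<in> Units S. c u \<otimes> b = act u b"
begin

abbreviation fixed where "fixed \<equiv> {a \<in> carrier A. \<forall>u \<in> Units S. act u a = a}"
abbreviation AU where "AU \<equiv> A\<lparr>carrier := fixed\<rparr>"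
abbreviation SU where "SU \<equiv> S Mod Units S"
abbreviation V where "V \<equiv> G\<lparr>carrier := Units S\<rparr>"
abbreviation coset where "coset x \<equiv> Units S #>\<^bsub>S\<^esub> x"

sublocale CS: cochain_module A "zero_tuples S z" S act
  by (rule M.cochain_module)

sublocale CQ: cochain_module AU "zero_tuples SU {z}" SU qact
  by (rule Q.cochain_module)

text \<open>Reconciles the two products in play: group cohomology of \<open>V\<close> uses that of
  \<open>G\<close>, 0-cohomology that of \<open>S\<close>.\<close>

lemma mult_units:
  assumes "u \<in> Units S" "v \<in> Units S"
  shows "u \<otimes>\<^bsub>S\<^esub> v = u \<otimes>\<^bsub>G\<^esub> v"
  using assms Units_subset by (intro mult_S_nonzero unit_mult_nonzero(1)) auto

lemma monoid_V: "monoid V"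
proof (rule monoidI)
  show "\<one>\<^bsub>V\<^esub> \<in> carrier V" using S.Units_one_closed one_S by simp
  show "x \<otimes>\<^bsub>V\<^esub> y \<in> carrier V" if "x \<in> carrier V" "y \<in> carrier V" for x y
    using that S.Units_m_closed mult_units by simp
qed (use Units_subset in \<open>auto simp: subset_iff G.m_assoc\<close>)

sublocale CU: cochain_module A "all_tuples V" V act
proof (rule cochain_module_all_tuples[OF monoid_V M.A.comm_group_axioms])
  fix v assume "v \<in> carrier V"
  then show "act v \<in> hom A A"
    using unit_nonzero[of v] M.act_closed M.act_mult by (intro homI) auto
next
  fix u v a assume uv: "u \<in> carrier V" "v \<in> carrier V" and a: "a \<in> carrier A"
  have "v \<in> carrier G" using uv(2) Units_subset by auto
  then have "u \<otimes>\<^bsub>S\<^esub> v \<noteq> z" using unit_mult_nonzero(1) uv(1) by simp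
  then show "act u (act v a) = act (u \<otimes>\<^bsub>V\<^esub> v) a"
    using M.act_act[OF unit_nonzero unit_nonzero _ a] uv mult_units by simp
qed

section \<open>Moving units across factors, and comparing cosets\<close>

lemma unit_swap:
  assumes "x \<in> carrier S" "u \<in> Units S"
  obtains v where "v \<in> Units S" "u \<otimes>\<^bsub>S\<^esub> x = x \<otimes>\<^bsub>S\<^esub> v"
proof -
  have "u \<otimes>\<^bsub>S\<^esub> x \<in> x <#\<^bsub>S\<^esub> Units S" using assms norm by (auto simp: r_coset_def)
  then show ?thesis using that by (auto simp: l_coset_def)
qed

lemma unit_swap':
  assumes "x \<in> carrier S" "u \<in> Units S"
  obtains v where "v \<in> Units S" "x \<otimes>\<^bsub>S\<^esub> u = v \<otimes>\<^bsub>S\<^esub> x"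
proof -
  have "x \<otimes>\<^bsub>S\<^esub> u \<in> Units S #>\<^bsub>S\<^esub> x" using assms norm by (auto simp: l_coset_def)
  then show ?thesis using that by (auto simp: r_coset_def)
qed

lemma mult_unit_eq_zero_iff:
  assumes "x \<in> carrier S" "u \<in> Units S"
  shows "x \<otimes>\<^bsub>S\<^esub> u = z \<longleftrightarrow> x = z" "u \<otimes>\<^bsub>S\<^esub> x = z \<longleftrightarrow> x = z"
  using assms unit_mult_nonzero[of u x] mult_zero zero_mult S.Units_closed carrier_S by auto

lemma unit_mult_pair:
  assumes "x \<in> carrier S" "y \<in> carrier S" "x \<otimes>\<^bsub>S\<^esub> y \<noteq> z" "u \<in> Units S"
  shows "x \<otimes>\<^bsub>S\<^esub> (y \<otimes>\<^bsub>S\<^esub> u) \<noteq> z" "x \<otimes>\<^bsub>S\<^esub> (u \<otimes>\<^bsub>S\<^esub> y) \<noteq> z" "x \<otimes>\<^bsub>S\<^esub> u \<otimes>\<^bsub>S\<^esub> y \<noteq> z"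
    "u \<otimes>\<^bsub>S\<^esub> x \<otimes>\<^bsub>S\<^esub> y \<noteq> z"
proof -
  note u = S.Units_closed[OF assms(4)]
  have xy: "x \<otimes>\<^bsub>S\<^esub> y \<in> carrier S" using assms by simp
  have 1: "x \<otimes>\<^bsub>S\<^esub> (y \<otimes>\<^bsub>S\<^esub> v) \<noteq> z" if "v \<in> Units S" for v
    using mult_unit_eq_zero_iff[OF xy that] assms S.Units_closed[OF that] by (simp add: S.m_assoc)
  show "x \<otimes>\<^bsub>S\<^esub> (y \<otimes>\<^bsub>S\<^esub> u) \<noteq> z" by (rule 1[OF assms(4)])
  \<comment> \<open>Writing \<open>u y = y v\<close> moves the unit to the right end of the product,
    where 1 applies.\<close>
  show 2: "x \<otimes>\<^bsub>S\<^esub> (u \<otimes>\<^bsub>S\<^esub> y) \<noteq> z"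
    using unit_swap[OF assms(2,4)] 1 by metis
  show "x \<otimes>\<^bsub>S\<^esub> u \<otimes>\<^bsub>S\<^esub> y \<noteq> z" using 2 assms u by (simp add: S.m_assoc)
  show "u \<otimes>\<^bsub>S\<^esub> x \<otimes>\<^bsub>S\<^esub> y \<noteq> z"
    using mult_unit_eq_zero_iff[OF xy assms(4)] assms u by (simp add: S.m_assoc)
qed

lemma coset_mult_unit:
  assumes "x \<in> carrier S" "u \<in> Units S"
  shows "coset (u \<otimes>\<^bsub>S\<^esub> x) = coset x" "coset (x \<otimes>\<^bsub>S\<^esub> u) = coset x"
proof -
  have 1: "coset (v \<otimes>\<^bsub>S\<^esub> x) = coset x" if v: "v \<in> Units S" for v
  proof -
    have "w \<otimes>\<^bsub>S\<^esub> (v \<otimes>\<^bsub>S\<^esub> x) \<in> coset x" if "w \<in> Units S" for w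
      using that v assms S.Units_m_closed[OF that v]
      by (auto simp: r_coset_def S.m_assoc[symmetric] S.Units_closed)
    moreover have "w \<otimes>\<^bsub>S\<^esub> x \<in> coset (v \<otimes>\<^bsub>S\<^esub> x)" if w: "w \<in> Units S" for w
    proof -
      have "w \<otimes>\<^bsub>S\<^esub> x = (w \<otimes>\<^bsub>S\<^esub> inv\<^bsub>S\<^esub> v) \<otimes>\<^bsub>S\<^esub> (v \<otimes>\<^bsub>S\<^esub> x)"
        using w v assms by (metis S.Units_closed S.Units_inv_closed S.Units_l_inv S.l_one S.m_assoc S.m_closed)
      then show ?thesis
        using S.Units_m_closed[OF w S.Units_inv_Units[OF v]] by (auto simp: r_coset_def)
    qed
    ultimately show ?thesis unfolding r_coset_def by blast
  qed
  show "coset (u \<otimes>\<^bsub>S\<^esub> x) = coset x" by (rule 1[OF assms(2)])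
  show "coset (x \<otimes>\<^bsub>S\<^esub> u) = coset x" using unit_swap'[OF assms] 1 by metis
qed

text \<open>Cosets carry the unit on the left; normality puts it on the right, the side on which
  normalised cocycles are first seen to be invariant.\<close>

lemma coset_eqE:
  assumes "x \<in> carrier S" "y \<in> carrier S" "coset x = coset y"
  obtains u where "u \<in> Units S" "x = y \<otimes>\<^bsub>S\<^esub> u"
proof -
  have "\<one>\<^bsub>S\<^esub> \<otimes>\<^bsub>S\<^esub> x \<in> coset x" using S.Units_one_closed unfolding r_coset_def by blast
  then have "x \<in> y <#\<^bsub>S\<^esub> Units S" using assms norm by simp
  then show ?thesis using that by (auto simp: l_coset_def)
qed

lemma coset_eq_Units_iff:
  assumes "x \<in> carrier S"
  shows "coset x = coset \<one>\<^bsub>S\<^esub> \<longleftrightarrow> x \<in> Units S"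
proof
  assume "coset x = coset \<one>\<^bsub>S\<^esub>"
  then obtain u where "u \<in> Units S" "x = \<one>\<^bsub>S\<^esub> \<otimes>\<^bsub>S\<^esub> u"
    by (rule coset_eqE[OF assms S.one_closed])
  then show "x \<in> Units S" by (simp add: S.Units_closed)
next
  assume "x \<in> Units S"
  then show "coset x = coset \<one>\<^bsub>S\<^esub>"
    using coset_mult_unit(2)[OF S.one_closed, of x] by (simp add: S.Units_closed)
qed

lemma carrier_SU: "carrier SU = coset ` carrier S"
  by (auto simp: FactGroup_def RCOSETS_def)

lemma mult_SU: "x \<in> carrier S \<Longrightarrow> y \<in> carrier S \<Longrightarrow> coset x \<otimes>\<^bsub>SU\<^esub> coset y = coset (x \<otimes>\<^bsub>S\<^esub> y)"
  using coset_mult[OF norm] by (simp add: FactGroup_def)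

lemma coset_closed: "x \<in> carrier S \<Longrightarrow> coset x \<in> carrier SU"
  by (simp only: carrier_SU imageI)

lemma coset_tuples_1: "[coset x] \<in> zero_tuples SU {z} (Suc 0)" if "x \<in> carrier S - {z}"
  using that coset_eq_zero_iff[of x] coset_closed[of x] by (simp only: zero_tuples_1) blast

text \<open>Admissibility can be tested on representatives, because only the zero of
  \<open>S\<close> has the zero of the quotient as its coset.\<close>

lemma coset_tuples_2:
  assumes "x \<in> carrier S" "y \<in> carrier S"
  shows "[coset x, coset y] \<in> zero_tuples SU {z} 2 \<longleftrightarrow> x \<otimes>\<^bsub>S\<^esub> y \<noteq> z"
  using assms coset_eq_zero_iff[of "x \<otimes>\<^bsub>S\<^esub> y"]
  by (simp only: zero_tuples_2 coset_closed mult_SU S.m_closed simp_thms)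

lemma coset_tuples_3:
  assumes "x \<in> carrier S" "y \<in> carrier S" "w \<in> carrier S"
  shows "[coset x, coset y, coset w] \<in> zero_tuples SU {z} 3 \<longleftrightarrow> x \<otimes>\<^bsub>S\<^esub> y \<otimes>\<^bsub>S\<^esub> w \<noteq> z"
  using assms coset_eq_zero_iff[of "x \<otimes>\<^bsub>S\<^esub> y \<otimes>\<^bsub>S\<^esub> w"]
  by (simp only: zero_tuples_3 coset_closed mult_SU S.m_closed simp_thms)

section \<open>Inflation of 2-cochains\<close>

abbreviation infl :: "('g set list \<Rightarrow> 'a) \<Rightarrow> 'g list \<Rightarrow> 'a"
  where "infl f \<equiv> \<lambda>s\<in>zero_tuples S z 2. f (map coset s)"

lemma infl_apply: "x \<in> carrier S \<Longrightarrow> y \<in> carrier S \<Longrightarrow> x \<otimes>\<^bsub>S\<^esub> y \<noteq> z \<Longrightarrow>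
    infl f [x, y] = f [coset x, coset y]"
  by (simp add: zero_tuples_2)

lemma map_coset_tuples:
  assumes s: "s \<in> zero_tuples S z 2"
  shows "map coset s \<in> zero_tuples SU {z} 2"
proof -
  obtain x y where xy: "s = [x, y]" using CS.D2_cases[OF s] by blast
  show ?thesis using s coset_tuples_2[of x y] unfolding xy list.map zero_tuples_2[of x y] by blast
qed

lemma carrier_AU: "carrier AU = fixed"
  by simp

lemma cochains_fixed: "f \<in> carrier CQ.C2 \<Longrightarrow> s \<in> zero_tuples SU {z} 2 \<Longrightarrow> f s \<in> fixed"
  using CQ.cochains_apply[of f 2 s] by (simp only: carrier_AU)

lemma fixed_apply:
  assumes "f \<in> carrier CQ.C2" "x \<in> carrier S" "y \<in> carrier S" "x \<otimes>\<^bsub>S\<^esub> y \<noteq> z"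
  shows "f [coset x, coset y] \<in> fixed"
  by (rule cochains_fixed[OF assms(1) iffD2[OF coset_tuples_2[OF assms(2,3)] assms(4)]])

lemma infl_cochain:
  assumes f: "f \<in> carrier CQ.C2"
  shows "infl f \<in> carrier CS.C2"
proof (rule CS.cochainsI)
  fix s assume s: "s \<in> zero_tuples S z 2"
  show "infl f s \<in> carrier A"
    using cochains_fixed[OF f map_coset_tuples[OF s]] s by simp
qed simp

lemma infl_cocycle:
  assumes f: "f \<in> CQ.Z2"
  shows "infl f \<in> CS.Z2"
proof -
  have fc: "f \<in> carrier CQ.C2" using f by (simp add: CQ.cocycle_iff)
  have "act x (infl f [y, w]) \<otimes> infl f [x, y \<otimes>\<^bsub>S\<^esub> w] = infl f [x \<otimes>\<^bsub>S\<^esub> y, w] \<otimes> infl f [x, y]"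
    if t: "[x, y, w] \<in> zero_tuples S z 3" for x y w
  proof -
    have c: "x \<in> carrier S" "y \<in> carrier S" "w \<in> carrier S" and nz: "x \<otimes>\<^bsub>S\<^esub> y \<otimes>\<^bsub>S\<^esub> w \<noteq> z"
      using t by (simp_all add: zero_tuples_3)
    have nz2: "x \<otimes>\<^bsub>S\<^esub> y \<noteq> z" "y \<otimes>\<^bsub>S\<^esub> w \<noteq> z" "x \<otimes>\<^bsub>S\<^esub> (y \<otimes>\<^bsub>S\<^esub> w) \<noteq> z"
      using CS.tripleD[OF t] by (simp_all add: zero_tuples_2)
    have x: "x \<in> carrier S - {z}" using CS.tripleD1[OF t] by (simp add: zero_tuples_1)
    have "qact (coset x) (f [coset y, coset w]) = act x (f [coset y, coset w])"
      using fixed_apply[OF fc c(2,3) nz2(2)] by (intro qact_coset[OF x]) auto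
    moreover have "qact (coset x) (f [coset y, coset w]) \<otimes> f [coset x, coset y \<otimes>\<^bsub>SU\<^esub> coset w] =
        f [coset x \<otimes>\<^bsub>SU\<^esub> coset y, coset w] \<otimes> f [coset x, coset y]"
      using f coset_tuples_3[OF c] nz by (simp add: CQ.cocycle_iff)
    ultimately show ?thesis
      using c nz nz2 by (simp only: infl_apply[of _ _ f] mult_SU S.m_closed simp_thms)
  qed
  then show ?thesis using infl_cochain[OF fc] unfolding CS.cocycle_iff by blast
qed

lemma infl_coboundary:
  assumes "f \<in> CQ.B2"
  shows "infl f \<in> CS.B2"
proof -
  obtain k where fc: "f \<in> carrier CQ.C2" and k: "\<And>C. [C] \<in> zero_tuples SU {z} 1 \<Longrightarrow> k C \<in> fixed"
    and fk: "\<And>C D. [C, D] \<in> zero_tuples SU {z} 2 \<Longrightarrow>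
      f [C, D] \<otimes> k (C \<otimes>\<^bsub>SU\<^esub> D) = qact C (k D) \<otimes> k C"
    using assms unfolding CQ.coboundary_iff by auto
  have kc: "k (coset x) \<in> fixed" if "x \<in> carrier S - {z}" for x
    using k coset_tuples_1[OF that] by simp
  have "infl f [x, y] \<otimes> k (coset (x \<otimes>\<^bsub>S\<^esub> y)) = act x (k (coset y)) \<otimes> k (coset x)"
    if t: "[x, y] \<in> zero_tuples S z 2" for x y
  proof -
    have c: "x \<in> carrier S" "y \<in> carrier S" and nz: "x \<otimes>\<^bsub>S\<^esub> y \<noteq> z"
      using t by (simp_all add: zero_tuples_2)
    have xy: "x \<in> carrier S - {z}" "y \<in> carrier S - {z}"
      using CS.pairD[OF t] by (simp_all add: zero_tuples_1)
    have "qact (coset x) (k (coset y)) = act x (k (coset y))"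
      using kc[OF xy(2)] by (intro qact_coset[OF xy(1)]) auto
    then show ?thesis
      using fk[of "coset x" "coset y"] coset_tuples_2[OF c] nz
      by (simp only: infl_apply[OF c nz] mult_SU[OF c] simp_thms)
  qed
  then show ?thesis unfolding CS.coboundary_iff
    using infl_cochain[OF fc] kc
    by (intro conjI exI[of _ "\<lambda>x. k (coset x)"]) (auto simp: zero_tuples_1)
qed

section \<open>Restriction of 2-cochains to the units\<close>

lemma tuples_V_subset: "all_tuples V 2 \<subseteq> zero_tuples S z 2"
proof
  fix s assume s: "s \<in> all_tuples V 2"
  obtain u v where "s = [u, v]" using CU.D2_cases[OF s] by blast
  then show "s \<in> zero_tuples S z 2"
    using s unit_mult_nonzero(1)[of u v] Units_subset S.Units_closed
    by (auto simp: all_tuples_2 zero_tuples_2)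
qed

lemma restrict_cochain:
  assumes f: "f \<in> carrier CS.C2"
  shows "restrict f (all_tuples V 2) \<in> carrier CU.C2"
proof (rule CU.cochainsI)
  fix s assume s: "s \<in> all_tuples V 2"
  show "restrict f (all_tuples V 2) s \<in> carrier A"
    using CS.cochains_apply[OF f subsetD[OF tuples_V_subset s]] s by simp
qed simp

lemma cocycle_eq:
  assumes "f \<in> CS.Z2" "x \<in> carrier S" "y \<in> carrier S" "w \<in> carrier S" "x \<otimes>\<^bsub>S\<^esub> y \<otimes>\<^bsub>S\<^esub> w \<noteq> z"
  shows "act x (f [y, w]) \<otimes> f [x, y \<otimes>\<^bsub>S\<^esub> w] = f [x \<otimes>\<^bsub>S\<^esub> y, w] \<otimes> f [x, y]"
  using assms by (simp add: CS.cocycle_iff zero_tuples_3)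

lemma restrict_cocycle:
  assumes f: "f \<in> CS.Z2"
  shows "restrict f (all_tuples V 2) \<in> CU.Z2"
proof -
  have fc: "f \<in> carrier CS.C2" using f by (simp add: CS.cocycle_iff)
  have "act u (f [v, w]) \<otimes> f [u, v \<otimes>\<^bsub>G\<^esub> w] = f [u \<otimes>\<^bsub>G\<^esub> v, w] \<otimes> f [u, v]"
    if "u \<in> Units S" "v \<in> Units S" "w \<in> Units S" for u v w
    using cocycle_eq[OF f, of u v w] that S.Units_closed S.Units_m_closed
      unit_nonzero[of "u \<otimes>\<^bsub>S\<^esub> v \<otimes>\<^bsub>S\<^esub> w"] by (simp add: mult_units)
  then show ?thesis unfolding CU.cocycle_iff
    using restrict_cochain[OF fc] CU.tripleD by (auto simp: all_tuples_3)
qed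

lemma restrict_coboundary:
  assumes "f \<in> CS.B2"
  shows "restrict f (all_tuples V 2) \<in> CU.B2"
proof -
  obtain k where fc: "f \<in> carrier CS.C2" and k: "\<And>x. [x] \<in> zero_tuples S z 1 \<Longrightarrow> k x \<in> carrier A"
    and fk: "\<And>x y. [x, y] \<in> zero_tuples S z 2 \<Longrightarrow> f [x, y] \<otimes> k (x \<otimes>\<^bsub>S\<^esub> y) = act x (k y) \<otimes> k x"
    using assms unfolding CS.coboundary_iff by blast
  have "k u \<in> carrier A" if "u \<in> Units S" for u
    using k unit_nonzero[OF that] by (simp add: zero_tuples_1)
  moreover have "f [u, v] \<otimes> k (u \<otimes>\<^bsub>G\<^esub> v) = act u (k v) \<otimes> k u"
    if "u \<in> Units S" "v \<in> Units S" for u v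
    using fk[of u v] tuples_V_subset that mult_units[OF that] all_tuples_2[of u v V] by auto
  ultimately show ?thesis unfolding CU.coboundary_iff
    using restrict_cochain[OF fc]
    by (intro conjI exI[of _ k]) (auto simp: all_tuples_1 all_tuples_2)
qed

lemma infl_map: "subquotient_map CQ.C2 CQ.Z2 CQ.B2 CS.C2 CS.Z2 CS.B2 infl"
proof (intro subquotient_map.intro subquotient_map_axioms.intro CQ.subquotient CS.subquotient
    infl_cocycle infl_coboundary)
  fix f g assume "f \<in> CQ.Z2" "g \<in> CQ.Z2"
  show "infl (f \<otimes>\<^bsub>CQ.C2\<^esub> g) = infl f \<otimes>\<^bsub>CS.C2\<^esub> infl g"
    using map_coset_tuples by (auto simp: cochains_def intro!: restrict_ext)
qed

lemma restrict_map:
  "subquotient_map CS.C2 CS.Z2 CS.B2 CU.C2 CU.Z2 CU.B2 (\<lambda>f. restrict f (all_tuples V 2))"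
proof (intro subquotient_map.intro subquotient_map_axioms.intro CU.subquotient CS.subquotient
    restrict_cocycle restrict_coboundary)
  fix f g assume "f \<in> CS.Z2" "g \<in> CS.Z2"
  show "restrict (f \<otimes>\<^bsub>CS.C2\<^esub> g) (all_tuples V 2) =
      restrict f (all_tuples V 2) \<otimes>\<^bsub>CU.C2\<^esub> restrict g (all_tuples V 2)"
    using tuples_V_subset by (auto simp: cochains_def restrict_def fun_eq_iff subset_iff)
qed

section \<open>Changing a 0-cocycle within its class, and coset representatives\<close>

lemma mult_unit_mem:
  assumes "x \<in> carrier S - {z}" "u \<in> Units S"
  shows "x \<otimes>\<^bsub>S\<^esub> u \<in> carrier S - {z}" "u \<otimes>\<^bsub>S\<^esub> x \<in> carrier S - {z}"
  using assms mult_unit_eq_zero_iff[of x u] S.Units_closed[of u] by auto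

lemma one_mem: "\<one>\<^bsub>S\<^esub> \<in> carrier S - {z}"
  by (rule unit_nonzero[OF S.Units_one_closed])

lemma value_closed:
  assumes "f \<in> CS.Z2" "x \<in> carrier S" "y \<in> carrier S" "x \<otimes>\<^bsub>S\<^esub> y \<noteq> z"
  shows "f [x, y] \<in> carrier A"
proof -
  have "f \<in> carrier CS.C2" using assms(1) unfolding CS.cocycle_iff by blast
  then show ?thesis by (rule CS.cochains_apply) (simp add: assms zero_tuples_2)
qed

lemma act_unit:
  assumes "x \<in> carrier S - {z}"
  shows "act x \<one> = \<one>"
  using CS.act_one[of x] assms by (simp add: zero_tuples_1)

lemma modify_by_coboundary:
  assumes "f \<in> CS.Z2" and "\<And>x. x \<in> carrier S - {z} \<Longrightarrow> k x \<in> carrier A"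
  obtains f' where "f' \<in> CS.Z2" "CS.B2 #>\<^bsub>CS.C2\<^esub> f = CS.B2 #>\<^bsub>CS.C2\<^esub> f'"
    "\<And>x y. x \<in> carrier S \<Longrightarrow> y \<in> carrier S \<Longrightarrow> x \<otimes>\<^bsub>S\<^esub> y \<noteq> z \<Longrightarrow>
      f' [x, y] \<otimes> (act x (k y) \<otimes> k x) = f [x, y] \<otimes> k (x \<otimes>\<^bsub>S\<^esub> y)"
proof -
  have k: "k x \<in> carrier A" if "[x] \<in> zero_tuples S z 1" for x
    using assms(2) that by (simp add: zero_tuples_1)
  show ?thesis
  proof (rule CS.modify_by_coboundary[OF assms(1) k])
    fix f' assume f': "f' \<in> CS.Z2" "CS.B2 #>\<^bsub>CS.C2\<^esub> f = CS.B2 #>\<^bsub>CS.C2\<^esub> f'"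
      "\<And>x y. [x, y] \<in> zero_tuples S z 2 \<Longrightarrow>
        f' [x, y] \<otimes> (act x (k y) \<otimes> k x) = f [x, y] \<otimes> k (x \<otimes>\<^bsub>S\<^esub> y)"
    show ?thesis by (rule that[OF f'(1,2)]) (rule f'(3), simp add: zero_tuples_2)
  qed
qed

text \<open>The representative of the coset of units is some unit, not necessarily 1. Normalisations
  therefore have to hold for all units, not just for the identity.\<close>

definition rep :: "'g set \<Rightarrow> 'g"
  where "rep C = (SOME x. x \<in> carrier S - {z} \<and> coset x = C)"

lemma rep_coset:
  assumes "x \<in> carrier S - {z}"
  shows "rep (coset x) \<in> carrier S - {z}" "coset (rep (coset x)) = coset x"
  using someI[of "\<lambda>y. y \<in> carrier S - {z} \<and> coset y = coset x" x] assms
  unfolding rep_def by blast+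

text \<open>The descent principle: a function invariant under right multiplication by units may be
  evaluated at the chosen representative.\<close>

lemma coset_const:
  assumes h: "\<And>x u. x \<in> carrier S - {z} \<Longrightarrow> u \<in> Units S \<Longrightarrow> h (x \<otimes>\<^bsub>S\<^esub> u) = h x"
    and x: "x \<in> carrier S - {z}"
  shows "h (rep (coset x)) = h x"
proof -
  obtain u where "u \<in> Units S" "rep (coset x) = x \<otimes>\<^bsub>S\<^esub> u"
    using coset_eqE[of "rep (coset x)" x] rep_coset[OF x] x by blast
  then show ?thesis using h[OF x] by simp
qed

lemma rep_unit: "u \<in> Units S \<Longrightarrow> rep (coset u) \<in> Units S"
  using rep_coset[OF unit_nonzero] coset_eq_Units_iff S.Units_closed
  by (metis DiffD1)

text \<open>Neither product is zero, so both are products in the group \<open>G\<close>, where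
  \<open>x\<close> cancels. This makes the unit part of an element relative to its representative
  unique.\<close>

lemma mult_cancel_left:
  assumes "x \<in> carrier S - {z}" "u \<in> Units S" "v \<in> Units S" "x \<otimes>\<^bsub>S\<^esub> u = x \<otimes>\<^bsub>S\<^esub> v"
  shows "u = v"
proof -
  have x: "x \<in> carrier G" using assms(1) carrier_S by auto
  have uv: "u \<in> carrier G" "v \<in> carrier G" using assms(2,3) Units_subset by auto
  have "x \<otimes>\<^bsub>G\<^esub> u = x \<otimes>\<^bsub>G\<^esub> v"
    using assms(4) mult_S_nonzero[OF x uv(1) unit_mult_nonzero(2)[OF assms(2) x]]
      mult_S_nonzero[OF x uv(2) unit_mult_nonzero(2)[OF assms(3) x]] by simp
  then show ?thesis using x uv by simp
qed

section \<open>Injectivity of inflation\<close>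

lemma infl_reflects_coboundaries:
  assumes f: "f \<in> CQ.Z2" and b: "infl f \<in> CS.B2"
  shows "f \<in> CQ.B2"
proof -
  have fc: "f \<in> carrier CQ.C2" using f unfolding CQ.cocycle_iff by blast
  obtain g where gk: "\<And>x. [x] \<in> zero_tuples S z 1 \<Longrightarrow> g x \<in> carrier A"
    and fk: "\<And>x y. [x, y] \<in> zero_tuples S z 2 \<Longrightarrow>
      infl f [x, y] \<otimes> g (x \<otimes>\<^bsub>S\<^esub> y) = act x (g y) \<otimes> g x"
    using b unfolding CS.coboundary_iff by blast
  have g: "g x \<in> carrier A" if "x \<in> carrier S - {z}" for x
    using gk that by (simp add: zero_tuples_1)
  have fg: "f [coset x, coset y] \<otimes> g (x \<otimes>\<^bsub>S\<^esub> y) = act x (g y) \<otimes> g x"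
    if "x \<in> carrier S" "y \<in> carrier S" "x \<otimes>\<^bsub>S\<^esub> y \<noteq> z" for x y
    using fk[of x y] that infl_apply[OF that, of f] by (simp add: zero_tuples_2)
  have fcl: "f [coset x, coset y] \<in> carrier A"
    if "x \<in> carrier S" "y \<in> carrier S" "x \<otimes>\<^bsub>S\<^esub> y \<noteq> z" for x y
    using fixed_apply[OF fc that] by blast
  let ?c = "f [coset \<one>\<^bsub>S\<^esub>, coset \<one>\<^bsub>S\<^esub>]"
  have c: "?c \<in> carrier A" "\<And>u. u \<in> Units S \<Longrightarrow> act u ?c = ?c"
    using fixed_apply[OF fc, of "\<one>\<^bsub>S\<^esub>" "\<one>\<^bsub>S\<^esub>"] one_mem by auto
  have inf: "infl f \<in> CS.Z2" by (rule infl_cocycle[OF f])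
  \<comment> \<open>The cocycle identity for \<open>(1, 1, x)\<close>, in which 1 acts trivially on
    the fixed value of \<open>f\<close>.\<close>
  have f1: "f [coset u, coset x] = ?c" if u: "u \<in> Units S" and x: "x \<in> carrier S - {z}" for u x
  proof -
    note cl = fixed_apply[OF fc, of "\<one>\<^bsub>S\<^esub>" x] fixed_apply[OF fc, of "\<one>\<^bsub>S\<^esub>" "\<one>\<^bsub>S\<^esub>"]
    have "act \<one>\<^bsub>S\<^esub> (infl f [\<one>\<^bsub>S\<^esub>, x]) \<otimes> infl f [\<one>\<^bsub>S\<^esub>, x] = infl f [\<one>\<^bsub>S\<^esub>, x] \<otimes> infl f [\<one>\<^bsub>S\<^esub>, \<one>\<^bsub>S\<^esub>]"
      using cocycle_eq[OF inf, of "\<one>\<^bsub>S\<^esub>" "\<one>\<^bsub>S\<^esub>" x] x by simp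
    then have "f [coset \<one>\<^bsub>S\<^esub>, coset x] \<otimes> f [coset \<one>\<^bsub>S\<^esub>, coset x] = f [coset \<one>\<^bsub>S\<^esub>, coset x] \<otimes> ?c"
      using x one_mem cl S.Units_one_closed infl_apply[of "\<one>\<^bsub>S\<^esub>" x f] infl_apply[of "\<one>\<^bsub>S\<^esub>" "\<one>\<^bsub>S\<^esub>" f]
      by simp
    then have "f [coset \<one>\<^bsub>S\<^esub>, coset x] = ?c"
      using cl one_mem x by simp
    moreover have "coset u = coset \<one>\<^bsub>S\<^esub>" using coset_eq_Units_iff u S.Units_closed by blast
    ultimately show ?thesis by (simp only:)
  qed
  \<comment> \<open>The identity for \<open>(x, 1, 1)\<close>; here the constant is moved by
    \<open>x\<close>.\<close>
  have f2: "f [coset x, coset u] = act x ?c" if u: "u \<in> Units S" and x: "x \<in> carrier S - {z}" for u x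
  proof -
    note cl = fixed_apply[OF fc, of x "\<one>\<^bsub>S\<^esub>"]
    have "act x (infl f [\<one>\<^bsub>S\<^esub>, \<one>\<^bsub>S\<^esub>]) \<otimes> infl f [x, \<one>\<^bsub>S\<^esub>] = infl f [x, \<one>\<^bsub>S\<^esub>] \<otimes> infl f [x, \<one>\<^bsub>S\<^esub>]"
      using cocycle_eq[OF inf, of x "\<one>\<^bsub>S\<^esub>" "\<one>\<^bsub>S\<^esub>"] x by simp
    then have "act x ?c \<otimes> f [coset x, coset \<one>\<^bsub>S\<^esub>] = f [coset x, coset \<one>\<^bsub>S\<^esub>] \<otimes> f [coset x, coset \<one>\<^bsub>S\<^esub>]"
      using x one_mem infl_apply[of x "\<one>\<^bsub>S\<^esub>" f] infl_apply[of "\<one>\<^bsub>S\<^esub>" "\<one>\<^bsub>S\<^esub>" f]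
      by simp
    then have "act x ?c = f [coset x, coset \<one>\<^bsub>S\<^esub>]"
      using cl x M.act_closed[OF x c(1)] by simp
    moreover have "coset u = coset \<one>\<^bsub>S\<^esub>" using coset_eq_Units_iff u S.Units_closed by blast
    ultimately show ?thesis by (simp only:)
  qed
  \<comment> \<open>On units, \<open>fg\<close> reads \<open>c g(uv) = u(g(v)) g(u)\<close> with the
    constant \<open>c = ?c\<close>. Dividing by the square of \<open>c\<close>, which the units fix,
    makes \<open>g / c\<close> a 1-cocycle.\<close>
  have "\<exists>b \<in> carrier A. \<forall>u \<in> Units S. (g u \<otimes> inv ?c) \<otimes> b = act u b"
  proof (rule hilbert90)
    fix u assume u: "u \<in> Units S"
    show "g u \<otimes> inv ?c \<in> carrier A" using g[OF unit_nonzero[OF u]] c by simp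
  next
    fix u v assume u: "u \<in> Units S" and v: "v \<in> Units S"
    note uv = S.Units_m_closed[OF u v]
    note un = unit_nonzero[OF u] and vn = unit_nonzero[OF v]
    note cl = c(1) g[OF un] g[OF vn] g[OF unit_nonzero[OF uv]] M.act_closed[OF un g[OF vn]]
    have e: "?c \<otimes> g (u \<otimes>\<^bsub>S\<^esub> v) = act u (g v) \<otimes> g u"
      using fg[of u v] f1[OF u vn] un vn unit_nonzero[OF uv] by simp
    have ci: "act u (inv ?c) = inv ?c"
      using CS.act_inv[of u ?c] un c u by (simp add: zero_tuples_1)
    have "act u (g v \<otimes> inv ?c) \<otimes> (g u \<otimes> inv ?c) = (act u (g v) \<otimes> g u) \<otimes> inv ?c \<otimes> inv ?c"
      using cl ci M.act_mult[OF un g[OF vn], of "inv ?c"] by (simp add: M.A.m_ac)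
    also have "\<dots> = g (u \<otimes>\<^bsub>S\<^esub> v) \<otimes> inv ?c"
      unfolding e[symmetric] using cl by (simp add: M.A.m_ac)
    finally show "g (u \<otimes>\<^bsub>S\<^esub> v) \<otimes> inv ?c = act u (g v \<otimes> inv ?c) \<otimes> (g u \<otimes> inv ?c)" ..
  qed
  then obtain b where b: "b \<in> carrier A"
    and gb: "\<And>u. u \<in> Units S \<Longrightarrow> (g u \<otimes> inv ?c) \<otimes> b = act u b" by blast
  \<comment> \<open>The map \<open>x \<mapsto> x b / b\<close> satisfies the 1-cocycle identity
    wherever products are nonzero, so dividing \<open>g\<close> by it keeps the coboundary, while on
    units it leaves exactly the constant \<open>?c\<close>.\<close>
  define h where "h x = g x \<otimes> b \<otimes> inv (act x b)" for x
  have h: "h x \<in> carrier A" if "x \<in> carrier S - {z}" for x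
    unfolding h_def using g[OF that] b M.act_closed[OF that b] by simp
  have hu: "h u = ?c" if u: "u \<in> Units S" for u
  proof -
    note un = unit_nonzero[OF u]
    have "g u \<otimes> b = ?c \<otimes> act u b"
      unfolding gb[OF u, symmetric] using g[OF un] b c
      by (simp add: M.A.m_ac)
    then show ?thesis
      unfolding h_def using M.act_closed[OF un b] c b by (simp add: M.A.m_assoc)
  qed
  have fh: "f [coset x, coset y] \<otimes> h (x \<otimes>\<^bsub>S\<^esub> y) = act x (h y) \<otimes> h x"
    if xy: "x \<in> carrier S" "y \<in> carrier S" "x \<otimes>\<^bsub>S\<^esub> y \<noteq> z" for x y
  proof -
    have m: "x \<in> carrier S - {z}" "y \<in> carrier S - {z}" "x \<otimes>\<^bsub>S\<^esub> y \<in> carrier S - {z}"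
      using xy mult_zero zero_mult by auto
    note cl = fcl[OF xy] g[OF m(1)] g[OF m(2)] g[OF m(3)] b M.act_closed[OF m(1) b]
      M.act_closed[OF m(2) b] M.act_closed[OF m(3) b] M.act_closed[OF m(1) g[OF m(2)]]
    have i: "act x (inv (act y b)) = inv (act (x \<otimes>\<^bsub>S\<^esub> y) b)"
      using CS.act_inv[of x "act y b"] M.act_act[OF m(1,2) xy(3) b] m cl
      by (simp add: zero_tuples_1)
    have "act x (h y) = act x (g y) \<otimes> act x b \<otimes> inv (act (x \<otimes>\<^bsub>S\<^esub> y) b)"
      unfolding h_def i[symmetric] using cl M.act_mult[OF m(1)] by simp
    then have "act x (h y) \<otimes> h x = (act x (g y) \<otimes> g x) \<otimes> b \<otimes> inv (act (x \<otimes>\<^bsub>S\<^esub> y) b)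
        \<otimes> (act x b \<otimes> inv (act x b))"
    proof -
      have e: "p \<otimes> q \<otimes> i \<otimes> (r \<otimes> b \<otimes> j) = (p \<otimes> r) \<otimes> b \<otimes> i \<otimes> (q \<otimes> j)"
        if "p \<in> carrier A" "q \<in> carrier A" "i \<in> carrier A" "r \<in> carrier A" "j \<in> carrier A" for p q i r j
        using that b by (simp add: M.A.m_ac)
      then show ?thesis using cl h_def[of x] \<open>act x (h y) = _\<close> by (simp only: e M.A.inv_closed)
    qed
    also have "\<dots> = f [coset x, coset y] \<otimes> h (x \<otimes>\<^bsub>S\<^esub> y)"
      unfolding fg[OF xy, symmetric] h_def using cl by (simp add: M.A.m_assoc)
    finally show ?thesis ..
  qed
  \<comment> \<open>In \<open>fh\<close> for \<open>(u, x)\<close> both \<open>f(U, xU)\<close> and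
    \<open>h u\<close> equal \<open>?c\<close> and cancel. For \<open>(x, u)\<close>, used in
    \<open>hr\<close>, the cancelling factor is \<open>?c\<close> moved by \<open>x\<close>.\<close>
  have hl: "h (u \<otimes>\<^bsub>S\<^esub> x) = act u (h x)" if u: "u \<in> Units S" and x: "x \<in> carrier S - {z}" for u x
  proof -
    note un = unit_nonzero[OF u] and ux = mult_unit_mem(2)[OF x u]
    have "?c \<otimes> h (u \<otimes>\<^bsub>S\<^esub> x) = act u (h x) \<otimes> ?c"
      using fh[of u x] f1[OF u x] hu[OF u] un x ux by simp
    then show ?thesis using h[OF ux] M.act_closed[OF un h[OF x]] c by (simp add: M.A.m_comm)
  qed
  have hr: "h (x \<otimes>\<^bsub>S\<^esub> u) = h x" if x: "x \<in> carrier S - {z}" and u: "u \<in> Units S" for u x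
  proof -
    note un = unit_nonzero[OF u] and xu = mult_unit_mem(1)[OF x u]
    have "act x ?c \<otimes> h (x \<otimes>\<^bsub>S\<^esub> u) = act x ?c \<otimes> h x"
      using fh[of x u] f2[OF u x] hu[OF u] un x xu by simp
    then show ?thesis using h[OF xu] h[OF x] M.act_closed[OF x c(1)] by simp
  qed
  \<comment> \<open>With \<open>u x = x v\<close>, the two invariances give
    \<open>u(h x) = h(u x) = h(x v) = h x\<close>. This is what puts the descended 1-cochain into
    the fixed elements.\<close>
  have hf: "act u (h x) = h x" if u: "u \<in> Units S" and x: "x \<in> carrier S - {z}" for u x
  proof -
    obtain v where "v \<in> Units S" "u \<otimes>\<^bsub>S\<^esub> x = x \<otimes>\<^bsub>S\<^esub> v" using unit_swap u x by blast
    then show ?thesis using hl[OF u x] hr[OF x] by metis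
  qed
  have rep: "h (rep (coset x)) = h x" if "x \<in> carrier S - {z}" for x
    using coset_const[of h, OF hr that] .
  have 1: "h (rep C) \<in> carrier AU" if "[C] \<in> zero_tuples SU {z} 1" for C
  proof -
    have "C \<in> carrier SU" "C \<noteq> {z}" using that by (simp_all only: zero_tuples_1 One_nat_def) auto
    then obtain x where x: "x \<in> carrier S - {z}" "C = coset x"
      unfolding carrier_SU using coset_zero by auto
    show ?thesis using h[OF x(1)] hf[OF _ x(1)] unfolding x(2) rep[OF x(1)] carrier_AU by blast
  qed
  have 2: "f [C, D] \<otimes>\<^bsub>AU\<^esub> h (rep (C \<otimes>\<^bsub>SU\<^esub> D)) = qact C (h (rep D)) \<otimes>\<^bsub>AU\<^esub> h (rep C)"
    if t: "[C, D] \<in> zero_tuples SU {z} 2" for C D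
  proof -
    have "C \<in> carrier SU" "D \<in> carrier SU" using t by (simp_all only: zero_tuples_2)
    then obtain x y where xy: "x \<in> carrier S" "y \<in> carrier S" and C: "C = coset x" and D: "D = coset y"
      unfolding carrier_SU by auto
    have nz: "x \<otimes>\<^bsub>S\<^esub> y \<noteq> z" using t unfolding C D coset_tuples_2[OF xy] .
    have m: "x \<in> carrier S - {z}" "y \<in> carrier S - {z}" "x \<otimes>\<^bsub>S\<^esub> y \<in> carrier S - {z}"
      using xy nz mult_zero zero_mult by auto
    have "qact C (h y) = act x (h y)"
      unfolding C by (rule qact_coset[OF m(1) h[OF m(2)] hf[OF _ m(2)]])
    then show ?thesis
      using fh[OF xy nz] unfolding C D mult_SU[OF xy] rep[OF m(1)] rep[OF m(2)] rep[OF m(3)] by simp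
  qed
  show ?thesis unfolding CQ.coboundary_iff
    by (intro conjI exI[of _ "\<lambda>C. h (rep C)"] allI impI fc 1 2)
qed

section \<open>Exactness in the middle\<close>

lemma trivialize_on_units:
  assumes f: "f \<in> CS.Z2" and b: "restrict f (all_tuples V 2) \<in> CU.B2"
  obtains f' where "f' \<in> CS.Z2" "CS.B2 #>\<^bsub>CS.C2\<^esub> f = CS.B2 #>\<^bsub>CS.C2\<^esub> f'"
    "\<And>u v. u \<in> Units S \<Longrightarrow> v \<in> Units S \<Longrightarrow> f' [u, v] = \<one>"
proof -
  obtain k where kc: "\<And>x. [x] \<in> all_tuples V 1 \<Longrightarrow> k x \<in> carrier A"
    and fk: "\<And>x y. [x, y] \<in> all_tuples V 2 \<Longrightarrow>
      restrict f (all_tuples V 2) [x, y] \<otimes> k (x \<otimes>\<^bsub>V\<^esub> y) = act x (k y) \<otimes> k x"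
    using b unfolding CU.coboundary_iff by blast
  have k: "k u \<in> carrier A" if "u \<in> Units S" for u
    using kc that by (simp add: all_tuples_1)
  have fu: "f [u, v] \<otimes> k (u \<otimes>\<^bsub>S\<^esub> v) = act u (k v) \<otimes> k u" if "u \<in> Units S" "v \<in> Units S" for u v
    using fk[of u v] that mult_units[OF that] by (simp add: all_tuples_2)
  \<comment> \<open>The splitting cochain is known on units only. Any extension with values in
    \<open>A\<close> would serve, since pairs of units involve its values on units alone.\<close>
  define l where "l x = (if x \<in> Units S then k x else \<one>)" for x
  have l: "l x \<in> carrier A" for x using k by (simp add: l_def)
  show ?thesis
  proof (rule modify_by_coboundary[OF f l])
    fix f' assume f': "f' \<in> CS.Z2" "CS.B2 #>\<^bsub>CS.C2\<^esub> f = CS.B2 #>\<^bsub>CS.C2\<^esub> f'"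
      and fl: "\<And>x y. x \<in> carrier S \<Longrightarrow> y \<in> carrier S \<Longrightarrow> x \<otimes>\<^bsub>S\<^esub> y \<noteq> z \<Longrightarrow>
        f' [x, y] \<otimes> (act x (l y) \<otimes> l x) = f [x, y] \<otimes> l (x \<otimes>\<^bsub>S\<^esub> y)"
    show ?thesis
    proof (rule that[OF f'])
      fix u v assume u: "u \<in> Units S" and v: "v \<in> Units S"
      note uv = S.Units_m_closed[OF u v]
      have c: "u \<in> carrier S" "v \<in> carrier S" "u \<otimes>\<^bsub>S\<^esub> v \<noteq> z"
        using unit_nonzero[OF u] unit_nonzero[OF v] unit_nonzero[OF uv] by auto
      have cl: "f' [u, v] \<in> carrier A" "act u (k v) \<otimes> k u \<in> carrier A"
        using value_closed[OF f'(1) c] k u v M.act_closed[OF unit_nonzero[OF u]] by auto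
      have "f' [u, v] \<otimes> (act u (k v) \<otimes> k u) = act u (k v) \<otimes> k u"
        using fl[OF c] fu[OF u v] u v uv by (simp add: l_def)
      then show "f' [u, v] = \<one>" using cl by simp
    qed
  qed
qed

lemma trivialize_right:
  assumes f: "f \<in> CS.Z2" and fuv: "\<And>u v. u \<in> Units S \<Longrightarrow> v \<in> Units S \<Longrightarrow> f [u, v] = \<one>"
  obtains f' where "f' \<in> CS.Z2" "CS.B2 #>\<^bsub>CS.C2\<^esub> f = CS.B2 #>\<^bsub>CS.C2\<^esub> f'"
    "\<And>x u. x \<in> carrier S - {z} \<Longrightarrow> u \<in> Units S \<Longrightarrow> f' [x, u] = \<one>"
proof -
  define e where "e x = (SOME u. u \<in> Units S \<and> x = rep (coset x) \<otimes>\<^bsub>S\<^esub> u)" for x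
  have e: "e x \<in> Units S" "x = rep (coset x) \<otimes>\<^bsub>S\<^esub> e x" if x: "x \<in> carrier S - {z}" for x
  proof -
    obtain u where "u \<in> Units S" "x = rep (coset x) \<otimes>\<^bsub>S\<^esub> u"
      using coset_eqE[of x "rep (coset x)"] rep_coset[OF x] x by (metis DiffD1)
    then have "\<exists>u. u \<in> Units S \<and> x = rep (coset x) \<otimes>\<^bsub>S\<^esub> u" by blast
    from someI_ex[OF this] show "e x \<in> Units S" "x = rep (coset x) \<otimes>\<^bsub>S\<^esub> e x"
      unfolding e_def by blast+
  qed
  \<comment> \<open>With \<open>x = r e(x)\<close>, the cocycle identity for \<open>(r, e(x), u)\<close> shows that dividing by the
    coboundary of this \<open>k\<close> removes \<open>f(x, u)\<close>.\<close>
  define k where "k x = inv f [rep (coset x), e x]" for x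
  have fcl: "f [x, u] \<in> carrier A" if "x \<in> carrier S - {z}" "u \<in> Units S" for x u
    using that mult_unit_mem[OF that] S.Units_closed[OF that(2)] by (intro value_closed[OF f]) auto
  have k: "k x \<in> carrier A" if x: "x \<in> carrier S - {z}" for x
    unfolding k_def using fcl[OF rep_coset(1)[OF x] e(1)[OF x]] by simp
  \<comment> \<open>The representative of a unit and the complementary factor are both units, where
    \<open>f\<close> is already trivial.\<close>
  have ku: "k u = \<one>" if u: "u \<in> Units S" for u
    unfolding k_def using fuv[OF rep_unit[OF u] e(1)[OF unit_nonzero[OF u]]] by simp
  show ?thesis
  proof (rule modify_by_coboundary[OF f k])
    fix f' assume f': "f' \<in> CS.Z2" "CS.B2 #>\<^bsub>CS.C2\<^esub> f = CS.B2 #>\<^bsub>CS.C2\<^esub> f'"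
      and fk: "\<And>x y. x \<in> carrier S \<Longrightarrow> y \<in> carrier S \<Longrightarrow> x \<otimes>\<^bsub>S\<^esub> y \<noteq> z \<Longrightarrow>
        f' [x, y] \<otimes> (act x (k y) \<otimes> k x) = f [x, y] \<otimes> k (x \<otimes>\<^bsub>S\<^esub> y)"
    show ?thesis
    proof (rule that[OF f'])
      fix x u assume x: "x \<in> carrier S - {z}" and u: "u \<in> Units S"
      let ?r = "rep (coset x)" and ?v = "e x"
      have r: "?r \<in> carrier S - {z}" by (rule rep_coset(1)[OF x])
      have v: "?v \<in> Units S" "x = ?r \<otimes>\<^bsub>S\<^esub> ?v" by (rule e[OF x])+
      note vu = S.Units_m_closed[OF v(1) u] and xu = mult_unit_mem(1)[OF x u]
      have cl: "u \<in> carrier S" "?v \<in> carrier S" "x \<in> carrier S" "?r \<in> carrier S"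
        using u v(1) x r S.Units_closed by auto
      have cx: "coset (x \<otimes>\<^bsub>S\<^esub> u) = coset x" by (rule coset_mult_unit(2)[OF cl(3) u])
      have assoc: "x \<otimes>\<^bsub>S\<^esub> u = ?r \<otimes>\<^bsub>S\<^esub> (?v \<otimes>\<^bsub>S\<^esub> u)"
        using S.m_assoc[OF cl(4,2,1)] v(2) by simp
      \<comment> \<open>The elements \<open>x\<close> and \<open>x u\<close> share their
        representative, so cancelling it yields \<open>e(x u) = e(x) u\<close>.\<close>
      have "?r \<otimes>\<^bsub>S\<^esub> e (x \<otimes>\<^bsub>S\<^esub> u) = ?r \<otimes>\<^bsub>S\<^esub> (?v \<otimes>\<^bsub>S\<^esub> u)"
        by (rule trans[OF sym[OF e(2)[OF xu, unfolded cx]] assoc])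
      then have ex: "e (x \<otimes>\<^bsub>S\<^esub> u) = ?v \<otimes>\<^bsub>S\<^esub> u"
        by (rule mult_cancel_left[OF r e(1)[OF xu] vu])
      have "act ?r (f [?v, u]) \<otimes> f [?r, ?v \<otimes>\<^bsub>S\<^esub> u] = f [?r \<otimes>\<^bsub>S\<^esub> ?v, u] \<otimes> f [?r, ?v]"
        using xu v(2) by (intro cocycle_eq[OF f] cl) auto
      then have coc: "f [?r, ?v \<otimes>\<^bsub>S\<^esub> u] = f [x, u] \<otimes> f [?r, ?v]"
        using fuv[OF v(1) u] act_unit[OF r] fcl[OF r vu] v(2) by simp
      have f'cl: "f' [x, u] \<in> carrier A"
        using cl xu by (intro value_closed[OF f'(1)]) auto
      have "f' [x, u] \<otimes> (act x (k u) \<otimes> k x) = f [x, u] \<otimes> k (x \<otimes>\<^bsub>S\<^esub> u)"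
        using cl xu by (intro fk) auto
      then have "f' [x, u] \<otimes> inv f [?r, ?v] = f [x, u] \<otimes> inv (f [x, u] \<otimes> f [?r, ?v])"
        using ku[OF u] act_unit[OF x] fcl[OF r v(1)]
        unfolding k_def[of x] k_def[of "x \<otimes>\<^bsub>S\<^esub> u"] cx ex coc by simp
      also have "\<dots> = inv f [?r, ?v]"
        using fcl[OF x u] fcl[OF r v(1)] by (simp add: M.A.inv_mult M.A.m_assoc[symmetric])
      finally show "f' [x, u] = \<one>" using f'cl fcl[OF r v(1)] by simp
    qed
  qed
qed

text \<open>In the cocycle identity for \<open>(x, y, u)\<close> the values \<open>f(y, u)\<close>
  and \<open>f(x y, u)\<close> are 1. The lemma serves both the last normalisation and the descent
  to cosets.\<close>

lemma right_trivial_invariant: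
  assumes f: "f \<in> CS.Z2" and fxu: "\<And>x u. x \<in> carrier S - {z} \<Longrightarrow> u \<in> Units S \<Longrightarrow> f [x, u] = \<one>"
    and xy: "x \<in> carrier S" "y \<in> carrier S" "x \<otimes>\<^bsub>S\<^esub> y \<noteq> z" and u: "u \<in> Units S"
  shows "f [x, y \<otimes>\<^bsub>S\<^esub> u] = f [x, y]"
proof -
  have m: "x \<in> carrier S - {z}" "y \<in> carrier S - {z}" "x \<otimes>\<^bsub>S\<^esub> y \<in> carrier S - {z}"
    using xy mult_zero zero_mult by auto
  note uc = S.Units_closed[OF u]
  have "act x (f [y, u]) \<otimes> f [x, y \<otimes>\<^bsub>S\<^esub> u] = f [x \<otimes>\<^bsub>S\<^esub> y, u] \<otimes> f [x, y]"
    using mult_unit_mem(1)[OF m(3) u] by (intro cocycle_eq[OF f] xy uc) auto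
  moreover have "f [x, y \<otimes>\<^bsub>S\<^esub> u] \<in> carrier A"
    using xy uc unit_mult_pair(1)[OF xy u] by (intro value_closed[OF f]) auto
  ultimately show ?thesis
    using fxu[OF m(2) u] fxu[OF m(3) u] act_unit[OF m(1)] value_closed[OF f xy] by simp
qed

lemma trivialize_left:
  assumes f: "f \<in> CS.Z2" and fxu: "\<And>x u. x \<in> carrier S - {z} \<Longrightarrow> u \<in> Units S \<Longrightarrow> f [x, u] = \<one>"
  obtains f' where "f' \<in> CS.Z2" "CS.B2 #>\<^bsub>CS.C2\<^esub> f = CS.B2 #>\<^bsub>CS.C2\<^esub> f'"
    "\<And>x u. x \<in> carrier S - {z} \<Longrightarrow> u \<in> Units S \<Longrightarrow> f' [x, u] = \<one>"
    "\<And>x u. x \<in> carrier S - {z} \<Longrightarrow> u \<in> Units S \<Longrightarrow> f' [u, x] = \<one>"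
proof -
  have fcl: "f [u, x] \<in> carrier A" if "x \<in> carrier S - {z}" "u \<in> Units S" for x u
    using that mult_unit_mem[OF that] S.Units_closed[OF that(2)] by (intro value_closed[OF f]) auto
  have inv: "f [u, x \<otimes>\<^bsub>S\<^esub> v] = f [u, x]" if "x \<in> carrier S - {z}" "u \<in> Units S" "v \<in> Units S" for x u v
    using that mult_unit_mem[OF that(1,2)] S.Units_closed[OF that(2)]
    by (intro right_trivial_invariant[OF f fxu]) auto
  \<comment> \<open>The choice \<open>b = 1\<close> on units will make \<open>k\<close> trivial
    there, so that the change of cocycle leaves \<open>f(x, u) = 1\<close> intact.\<close>
  have "\<exists>b. b \<in> carrier A \<and> (x \<in> Units S \<longrightarrow> b = \<one>) \<and> (\<forall>u \<in> Units S. f [u, x] \<otimes> b = act u b)"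
    if x: "x \<in> carrier S - {z}" for x
  proof (cases "x \<in> Units S")
    case True
    then show ?thesis
      using fxu act_unit unit_nonzero by (intro exI[of _ \<one>]) auto
  next
    case False
    \<comment> \<open>For fixed \<open>x\<close>, the map \<open>u \<mapsto> f(u, x)\<close> is a 1-cocycle on the units, since
      \<open>v x = x w\<close> and \<open>f(u, x w) = f(u, x)\<close>.\<close>
    have "\<exists>b \<in> carrier A. \<forall>u \<in> Units S. f [u, x] \<otimes> b = act u b"
    proof (rule hilbert90)
      show "f [u, x] \<in> carrier A" if "u \<in> Units S" for u by (rule fcl[OF x that])
      fix u v assume u: "u \<in> Units S" and v: "v \<in> Units S"
      obtain w where w: "w \<in> Units S" "v \<otimes>\<^bsub>S\<^esub> x = x \<otimes>\<^bsub>S\<^esub> w" using unit_swap v x by blast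
      note uv = S.Units_m_closed[OF u v]
      have "act u (f [v, x]) \<otimes> f [u, v \<otimes>\<^bsub>S\<^esub> x] = f [u \<otimes>\<^bsub>S\<^esub> v, x] \<otimes> f [u, v]"
        using mult_unit_mem(2)[OF x uv] u v x S.Units_closed by (intro cocycle_eq[OF f]) auto
      then show "f [u \<otimes>\<^bsub>S\<^esub> v, x] = act u (f [v, x]) \<otimes> f [u, x]"
        using fxu[OF unit_nonzero[OF u] v] fcl[OF x uv] inv[OF x u w(1)] unfolding w(2) by simp
    qed
    then show ?thesis using False by blast
  qed
  then obtain b where b: "\<And>x. x \<in> carrier S - {z} \<Longrightarrow> b x \<in> carrier A"
    and bu: "\<And>u. u \<in> Units S \<Longrightarrow> b u = \<one>"
    and fb: "\<And>x u. x \<in> carrier S - {z} \<Longrightarrow> u \<in> Units S \<Longrightarrow> f [u, x] \<otimes> b x = act u (b x)"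
    using unit_nonzero by metis
  \<comment> \<open>Taking \<open>b\<close> at representatives makes \<open>k\<close> constant on
    cosets, so \<open>k(x u) = k(u x) = k(x)\<close>. The equation for the representative passes to
    \<open>x\<close> because \<open>f(u, _)\<close> is constant on cosets too.\<close>
  define k where "k x = b (rep (coset x))" for x
  have k: "k x \<in> carrier A" if "x \<in> carrier S - {z}" for x
    unfolding k_def by (rule b[OF rep_coset(1)[OF that]])
  have ku: "k u = \<one>" if "u \<in> Units S" for u
    unfolding k_def by (rule bu[OF rep_unit[OF that]])
  have fk: "f [u, x] \<otimes> k x = act u (k x)" if x: "x \<in> carrier S - {z}" and u: "u \<in> Units S" for x u
    using fb[OF rep_coset(1)[OF x] u] coset_const[of "\<lambda>x. f [u, x]", OF inv[OF _ u] x]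
    unfolding k_def by simp
  show ?thesis
  proof (rule modify_by_coboundary[OF f k])
    fix f' assume f': "f' \<in> CS.Z2" "CS.B2 #>\<^bsub>CS.C2\<^esub> f = CS.B2 #>\<^bsub>CS.C2\<^esub> f'"
      and f'k: "\<And>x y. x \<in> carrier S \<Longrightarrow> y \<in> carrier S \<Longrightarrow> x \<otimes>\<^bsub>S\<^esub> y \<noteq> z \<Longrightarrow>
        f' [x, y] \<otimes> (act x (k y) \<otimes> k x) = f [x, y] \<otimes> k (x \<otimes>\<^bsub>S\<^esub> y)"
    show ?thesis
    proof (rule that[OF f'])
      fix x u assume x: "x \<in> carrier S - {z}" and u: "u \<in> Units S"
      note un = unit_nonzero[OF u] and m = mult_unit_mem[OF x u]
      have c: "x \<in> carrier S" "u \<in> carrier S" "x \<otimes>\<^bsub>S\<^esub> u \<noteq> z" "u \<otimes>\<^bsub>S\<^esub> x \<noteq> z"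
        using x un m by auto
      have kx: "k (x \<otimes>\<^bsub>S\<^esub> u) = k x" "k (u \<otimes>\<^bsub>S\<^esub> x) = k x"
        unfolding k_def coset_mult_unit[OF c(1) u] by (rule refl)+
      note kc = k[OF x] M.act_closed[OF un k[OF x]]
      have "f' [x, u] \<otimes> k x = k x"
        using f'k[OF c(1,2,3)] kx ku[OF u] act_unit[OF x] fxu[OF x u] kc by simp
      then show "f' [x, u] = \<one>" using kc value_closed[OF f'(1) c(1,2,3)] by simp
      have "f' [u, x] \<otimes> act u (k x) = act u (k x)"
        using f'k[OF c(2,1,4)] kx ku[OF u] fk[OF x u] kc by simp
      then show "f' [u, x] = \<one>" using kc value_closed[OF f'(1) c(2,1,4)] by simp
    qed
  qed
qed

text \<open>Three positions of a unit in a triple give three facts: last, invariance in the second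
  argument; middle, invariance in the first; first, values fixed by the units.\<close>

lemma descend_cocycle:
  assumes f: "f \<in> CS.Z2"
    and fxu: "\<And>x u. x \<in> carrier S - {z} \<Longrightarrow> u \<in> Units S \<Longrightarrow> f [x, u] = \<one>"
    and fux: "\<And>x u. x \<in> carrier S - {z} \<Longrightarrow> u \<in> Units S \<Longrightarrow> f [u, x] = \<one>"
  obtains F where "F \<in> CQ.Z2" "infl F = f"
proof -
  have right: "f [x, y \<otimes>\<^bsub>S\<^esub> u] = f [x, y]"
    if "x \<in> carrier S" "y \<in> carrier S" "x \<otimes>\<^bsub>S\<^esub> y \<noteq> z" "u \<in> Units S" for x y u
    using right_trivial_invariant[OF f fxu that] .
  \<comment> \<open>The identity for \<open>(x, u, y)\<close> reduces to
    \<open>f(x, u y) = f(x u, y)\<close>, and \<open>u y = y v\<close> makes the left side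
    \<open>f(x, y)\<close>.\<close>
  have left: "f [x \<otimes>\<^bsub>S\<^esub> u, y] = f [x, y]"
    if xy: "x \<in> carrier S" "y \<in> carrier S" "x \<otimes>\<^bsub>S\<^esub> y \<noteq> z" and u: "u \<in> Units S" for x y u
  proof -
    note uc = S.Units_closed[OF u] and p = unit_mult_pair[OF xy u]
    have m: "x \<in> carrier S - {z}" "y \<in> carrier S - {z}" using xy mult_zero zero_mult by auto
    obtain v where v: "v \<in> Units S" "u \<otimes>\<^bsub>S\<^esub> y = y \<otimes>\<^bsub>S\<^esub> v" using unit_swap[OF xy(2) u] by blast
    have "act x (f [u, y]) \<otimes> f [x, u \<otimes>\<^bsub>S\<^esub> y] = f [x \<otimes>\<^bsub>S\<^esub> u, y] \<otimes> f [x, u]"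
      by (intro cocycle_eq[OF f] xy uc p)
    moreover have "f [x \<otimes>\<^bsub>S\<^esub> u, y] \<in> carrier A" "f [x, y] \<in> carrier A"
      using xy uc p by (intro value_closed[OF f]; simp)+
    ultimately show ?thesis
      using fux[OF m(2) u] fxu[OF m(1) u] act_unit[OF m(1)] right[OF xy v(1)] unfolding v(2) by simp
  qed
  \<comment> \<open>The identity for \<open>(u, x, y)\<close> reduces to
    \<open>u(f(x, y)) = f(u x, y)\<close>, and \<open>u x = x v\<close> makes the right side
    \<open>f(x, y)\<close>.\<close>
  have fixed: "act u (f [x, y]) = f [x, y]"
    if xy: "x \<in> carrier S" "y \<in> carrier S" "x \<otimes>\<^bsub>S\<^esub> y \<noteq> z" and u: "u \<in> Units S" for x y u
  proof -
    note uc = S.Units_closed[OF u] and p = unit_mult_pair[OF xy u]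
    have m: "x \<in> carrier S - {z}" "x \<otimes>\<^bsub>S\<^esub> y \<in> carrier S - {z}" using xy zero_mult by auto
    obtain v where v: "v \<in> Units S" "u \<otimes>\<^bsub>S\<^esub> x = x \<otimes>\<^bsub>S\<^esub> v" using unit_swap[OF xy(1) u] by blast
    have "act u (f [x, y]) \<otimes> f [u, x \<otimes>\<^bsub>S\<^esub> y] = f [u \<otimes>\<^bsub>S\<^esub> x, y] \<otimes> f [u, x]"
      by (intro cocycle_eq[OF f] xy uc p)
    then show ?thesis
      using fux[OF m(1) u] fux[OF m(2) u] left[OF xy v(1)] value_closed[OF f xy]
        M.act_closed[OF unit_nonzero[OF u] value_closed[OF f xy]] unfolding v(2) by simp
  qed
  define F where "F = (\<lambda>s\<in>zero_tuples SU {z} 2. f (map rep s))"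
  have F: "F [coset x, coset y] = f [x, y]"
    if xy: "x \<in> carrier S" "y \<in> carrier S" "x \<otimes>\<^bsub>S\<^esub> y \<noteq> z" for x y
  proof -
    have m: "x \<in> carrier S - {z}" "y \<in> carrier S - {z}" using xy mult_zero zero_mult by auto
    obtain u where u: "u \<in> Units S" "rep (coset x) = x \<otimes>\<^bsub>S\<^esub> u"
      using coset_eqE[of "rep (coset x)" x] rep_coset[OF m(1)] m(1) by blast
    obtain v where v: "v \<in> Units S" "rep (coset y) = y \<otimes>\<^bsub>S\<^esub> v"
      using coset_eqE[of "rep (coset y)" y] rep_coset[OF m(2)] m(2) by blast
    \<comment> \<open>The representatives differ from \<open>x\<close> and \<open>y\<close> by units
      on the right, which the two invariances remove.\<close>
    have "F [coset x, coset y] = f [x \<otimes>\<^bsub>S\<^esub> u, y \<otimes>\<^bsub>S\<^esub> v]"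
      unfolding F_def using coset_tuples_2[OF xy(1,2)] xy(3) u(2) v(2)
      by (simp only: restrict_apply simp_thms if_True list.map)
    then show ?thesis
      using right[of "x \<otimes>\<^bsub>S\<^esub> u" y v] left[OF xy u(1)] unit_mult_pair(3)[OF xy u(1)] xy u(1) v(1)
        S.Units_closed by simp
  qed
  have reps: "\<exists>x y. x \<in> carrier S \<and> y \<in> carrier S \<and> x \<otimes>\<^bsub>S\<^esub> y \<noteq> z \<and> C = coset x \<and> D = coset y"
    if "[C, D] \<in> zero_tuples SU {z} 2" for C D
  proof -
    have "C \<in> carrier SU" "D \<in> carrier SU" using that by (simp_all only: zero_tuples_2)
    then obtain x y where "x \<in> carrier S" "y \<in> carrier S" "C = coset x" "D = coset y"
      unfolding carrier_SU by auto
    then show ?thesis using coset_tuples_2[of x y] that by blast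
  qed
  have Fc: "F \<in> carrier CQ.C2"
  proof (rule CQ.cochainsI)
    fix s assume s: "s \<in> zero_tuples SU {z} 2"
    obtain C D where CD: "s = [C, D]" using CQ.D2_cases[OF s] by blast
    obtain x y where xy: "x \<in> carrier S" "y \<in> carrier S" "x \<otimes>\<^bsub>S\<^esub> y \<noteq> z" "C = coset x" "D = coset y"
      using reps s unfolding CD by blast
    show "F s \<in> carrier AU"
      unfolding CD xy(4,5) F[OF xy(1,2,3)] carrier_AU
      using fixed[OF xy(1,2,3)] value_closed[OF f xy(1,2,3)] by blast
  qed (simp add: F_def)
  have "qact C (F [D, E]) \<otimes>\<^bsub>AU\<^esub> F [C, D \<otimes>\<^bsub>SU\<^esub> E] = F [C \<otimes>\<^bsub>SU\<^esub> D, E] \<otimes>\<^bsub>AU\<^esub> F [C, D]"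
    if t: "[C, D, E] \<in> zero_tuples SU {z} 3" for C D E
  proof -
    have "C \<in> carrier SU" "D \<in> carrier SU" "E \<in> carrier SU" using t by (simp_all only: zero_tuples_3)
    then obtain x y w where xyw: "x \<in> carrier S" "y \<in> carrier S" "w \<in> carrier S"
      and C: "C = coset x" "D = coset y" "E = coset w"
      unfolding carrier_SU by auto
    have nz: "x \<otimes>\<^bsub>S\<^esub> y \<otimes>\<^bsub>S\<^esub> w \<noteq> z" using t unfolding C coset_tuples_3[OF xyw] .
    then have nz2: "x \<otimes>\<^bsub>S\<^esub> y \<noteq> z" "y \<otimes>\<^bsub>S\<^esub> w \<noteq> z" "x \<otimes>\<^bsub>S\<^esub> (y \<otimes>\<^bsub>S\<^esub> w) \<noteq> z" and x: "x \<in> carrier S - {z}"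
      using xyw mult_zero zero_mult by (auto simp: S.m_assoc)
    have "qact C (f [y, w]) = act x (f [y, w])"
      unfolding C by (rule qact_coset[OF x value_closed[OF f xyw(2,3) nz2(2)] fixed[OF xyw(2,3) nz2(2)]])
    then show ?thesis
      using cocycle_eq[OF f xyw nz]
      unfolding C mult_SU[OF xyw(1,2)] mult_SU[OF xyw(2,3)] F[OF xyw(2,3) nz2(2)] F[OF xyw(1,2) nz2(1)]
        F[OF S.m_closed[OF xyw(1,2)] xyw(3) nz] F[OF xyw(1) S.m_closed[OF xyw(2,3)] nz2(3)]
      by simp
  qed
  then have FZ: "F \<in> CQ.Z2" using Fc unfolding CQ.cocycle_iff by blast
  have "infl F = f"
  proof (rule extensionalityI[of _ "zero_tuples S z 2"])
    show "f \<in> extensional (zero_tuples S z 2)"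
      using f unfolding CS.cocycle_iff by (auto simp: cochains_def PiE_iff)
    fix s assume s: "s \<in> zero_tuples S z 2"
    obtain x y where xy: "s = [x, y]" using CS.D2_cases[OF s] by blast
    then have c: "x \<in> carrier S" "y \<in> carrier S" "x \<otimes>\<^bsub>S\<^esub> y \<noteq> z" using s by (simp_all add: zero_tuples_2)
    show "infl F s = f s" unfolding xy infl_apply[OF c] by (rule F[OF c])
  qed simp
  then show ?thesis using that FZ by blast
qed

text \<open>On units the inflated cocycle is the constant \<open>?c\<close>, not 1. Its class is
  trivial because the constant 1-cochain \<open>?c\<close> has coboundary
  \<open>u(c) c / c = c\<close>.\<close>

lemma restrict_infl:
  assumes f: "f \<in> CQ.Z2"
  shows "restrict (infl f) (all_tuples V 2) \<in> CU.B2"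
proof -
  have fc: "f \<in> carrier CQ.C2" using f unfolding CQ.cocycle_iff by blast
  have c: "\<And>u. u \<in> Units S \<Longrightarrow> coset u = coset \<one>\<^bsub>S\<^esub>"
    using coset_eq_Units_iff S.Units_closed by blast
  let ?c = "f [coset \<one>\<^bsub>S\<^esub>, coset \<one>\<^bsub>S\<^esub>]"
  have cf: "?c \<in> carrier A" "\<And>u. u \<in> Units S \<Longrightarrow> act u ?c = ?c"
    using fixed_apply[OF fc, of "\<one>\<^bsub>S\<^esub>" "\<one>\<^bsub>S\<^esub>"] one_mem by auto
  have e: "restrict (infl f) (all_tuples V 2) [u, v] = ?c"
    if t: "[u, v] \<in> all_tuples V 2" for u v
  proof -
    have u: "u \<in> Units S" and v: "v \<in> Units S" using t by (simp_all add: all_tuples_2)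
    have "[u, v] \<in> zero_tuples S z 2" using tuples_V_subset t by blast
    then have uv: "u \<in> carrier S" "v \<in> carrier S" "u \<otimes>\<^bsub>S\<^esub> v \<noteq> z" by (simp_all add: zero_tuples_2)
    show ?thesis
      unfolding restrict_apply'[OF t] infl_apply[OF uv, of f] c[OF u] c[OF v] by (rule refl)
  qed
  have "restrict (infl f) (all_tuples V 2) [u, v] \<otimes> ?c = act u ?c \<otimes> ?c"
    if t: "[u, v] \<in> all_tuples V 2" for u v
    unfolding e[OF t] using cf(2)[of u] t by (simp add: all_tuples_2)
  then show ?thesis unfolding CU.coboundary_iff
    using restrict_cochain[OF infl_cochain[OF fc]] cf(1)
    by (intro conjI exI[of _ "\<lambda>_. ?c"] allI impI)
qed

theorem inflation_restriction:
  defines "H_quot \<equiv> zero_cohomology SU {z} AU qact 2"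
    and "H_S \<equiv> zero_cohomology S z A act 2"
    and "H_U \<equiv> group_cohomology V A act 2"
    and "\<psi> \<equiv> inflation S z A act coset 2"
    and "\<phi> \<equiv> restriction V A act 2"
  shows "group_hom H_quot H_S \<psi>" and "group_hom H_S H_U \<phi>"
    and "kernel H_quot H_S \<psi> = {\<one>\<^bsub>H_quot\<^esub>}"
    and "\<psi> ` carrier H_quot = kernel H_S H_U \<phi>"
proof -
  interpret I: subquotient_map CQ.C2 CQ.Z2 CQ.B2 CS.C2 CS.Z2 CS.B2 infl by (rule infl_map)
  interpret R: subquotient_map CS.C2 CS.Z2 CS.B2 CU.C2 CU.Z2 CU.B2 "\<lambda>f. restrict f (all_tuples V 2)"
    by (rule restrict_map)
  have eqs: "H_quot = I.S1.quot" "H_S = I.S2.quot" "H_U = R.S2.quot"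
    "\<psi> = induced_map CS.C2 CS.B2 infl"
    "\<phi> = induced_map CU.C2 CU.B2 (\<lambda>f. restrict f (all_tuples V 2))"
    by (simp_all only: H_quot_def H_S_def H_U_def \<psi>_def \<phi>_def cohomology_def inflation_def restriction_def)
  show "group_hom H_quot H_S \<psi>" unfolding eqs by (rule I.induced_map_hom)
  show "group_hom H_S H_U \<phi>" unfolding eqs by (rule R.induced_map_hom)
  have "B = CQ.B2" if "B \<in> kernel H_quot H_S \<psi>" for B
  proof -
    from that obtain f where "f \<in> CQ.Z2" "infl f \<in> CS.B2" "B = CQ.B2 #>\<^bsub>CQ.C2\<^esub> f"
      unfolding eqs I.kernel_induced_map by blast
    then show ?thesis using infl_reflects_coboundaries I.S1.coset_eq_B_iff by blast
  qed
  moreover have "\<one>\<^bsub>H_quot\<^esub> \<in> kernel H_quot H_S \<psi>"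
    using subgroup.one_closed[OF group_hom.subgroup_kernel[OF \<open>group_hom H_quot H_S \<psi>\<close>]] .
  moreover have "\<one>\<^bsub>H_quot\<^esub> = CQ.B2" unfolding eqs by (rule I.S1.one_quot)
  ultimately show "kernel H_quot H_S \<psi> = {\<one>\<^bsub>H_quot\<^esub>}" by blast
  have "\<exists>F. CS.B2 #>\<^bsub>CS.C2\<^esub> f = CS.B2 #>\<^bsub>CS.C2\<^esub> infl F \<and> F \<in> CQ.Z2"
    if f: "f \<in> CS.Z2" "restrict f (all_tuples V 2) \<in> CU.B2" for f
  proof -
    obtain f1 where f1: "f1 \<in> CS.Z2" "CS.B2 #>\<^bsub>CS.C2\<^esub> f = CS.B2 #>\<^bsub>CS.C2\<^esub> f1"
      "\<And>u v. u \<in> Units S \<Longrightarrow> v \<in> Units S \<Longrightarrow> f1 [u, v] = \<one>"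
      using trivialize_on_units[OF f] by blast
    obtain f2 where f2: "f2 \<in> CS.Z2" "CS.B2 #>\<^bsub>CS.C2\<^esub> f1 = CS.B2 #>\<^bsub>CS.C2\<^esub> f2"
      "\<And>x u. x \<in> carrier S - {z} \<Longrightarrow> u \<in> Units S \<Longrightarrow> f2 [x, u] = \<one>"
      using trivialize_right[OF f1(1,3)] by blast
    obtain f3 where f3: "f3 \<in> CS.Z2" "CS.B2 #>\<^bsub>CS.C2\<^esub> f2 = CS.B2 #>\<^bsub>CS.C2\<^esub> f3"
      "\<And>x u. x \<in> carrier S - {z} \<Longrightarrow> u \<in> Units S \<Longrightarrow> f3 [x, u] = \<one>"
      "\<And>x u. x \<in> carrier S - {z} \<Longrightarrow> u \<in> Units S \<Longrightarrow> f3 [u, x] = \<one>"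
      using trivialize_left[OF f2(1,3)] by blast
    obtain F where "F \<in> CQ.Z2" "infl F = f3"
      using descend_cocycle[OF f3(1,3,4)] by blast
    then show ?thesis unfolding f1(2) f2(2) f3(2) by (intro exI[of _ F]) simp
  qed
  then show "\<psi> ` carrier H_quot = kernel H_S H_U \<phi>"
    unfolding eqs I.image_induced_map R.kernel_induced_map
    using restrict_infl infl_cocycle by blast
qed

end

section \<open>Hilbert 90\<close>

text \<open>Dedekind's independence of characters. The homomorphisms are taken to be extensional so
  that distinct ones differ at some element of the field.\<close>

lemma (in field) ring_homs_independent:
  assumes "finite T" and "\<And>\<sigma>. \<sigma> \<in> T \<Longrightarrow> \<sigma> \<in> ring_hom R R \<inter> extensional (carrier R)"
    and "\<And>\<sigma>. \<sigma> \<in> T \<Longrightarrow> c \<sigma> \<in> carrier R"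
    and "\<And>a. a \<in> carrier R \<Longrightarrow> (\<Oplus>\<sigma>\<in>T. c \<sigma> \<otimes> \<sigma> a) = \<zero>"
  shows "\<forall>\<sigma>\<in>T. c \<sigma> = \<zero>"
  using assms
proof (induction T arbitrary: c rule: finite_induct)
  case (insert \<tau> T)
  note hom = insert.prems(1) and cc = insert.prems(2) and sum0 = insert.prems(3)
  have cl: "\<sigma> a \<in> carrier R" if "\<sigma> \<in> insert \<tau> T" "a \<in> carrier R" for \<sigma> a
    using hom[OF that(1)] that(2) by (auto dest: ring_hom_closed)
  have cT: "c \<sigma> \<in> carrier R" if "\<sigma> \<in> T" for \<sigma> using cc that by blast
  have split: "c \<tau> \<otimes> \<tau> a \<oplus> (\<Oplus>\<sigma>\<in>T. c \<sigma> \<otimes> \<sigma> a) = \<zero>" if a: "a \<in> carrier R" for a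
    using sum0[OF a] insert.hyps cl[OF _ a] cc by (subst (asm) finsum_insert) auto
  have zero: "c \<sigma> = \<zero>" if \<sigma>: "\<sigma> \<in> T" for \<sigma>
  proof -
    have "\<sigma> \<noteq> \<tau>" using \<sigma> insert.hyps(2) by blast
    moreover have "\<sigma> \<in> extensional (carrier R)" "\<tau> \<in> extensional (carrier R)" using hom \<sigma> by auto
    ultimately obtain b where b: "b \<in> carrier R" "\<sigma> b \<noteq> \<tau> b"
      using extensionalityI by metis
    note \<tau>b = cl[OF insertI1 b(1)]
    \<comment> \<open>Subtracting \<open>\<tau> b\<close> times the relation at \<open>a\<close>
      from the relation at \<open>b a\<close> eliminates \<open>\<tau>\<close>. The shorter relation
      has these coefficients, and the one at \<open>\<sigma>\<close> has a nonzero second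
      factor.\<close>
    have "\<forall>\<rho>\<in>T. c \<rho> \<otimes> (\<rho> b \<ominus> \<tau> b) = \<zero>"
    proof (rule insert.IH)
      show "\<rho> \<in> ring_hom R R \<inter> extensional (carrier R)" if "\<rho> \<in> T" for \<rho> using hom that by blast
      show "c \<rho> \<otimes> (\<rho> b \<ominus> \<tau> b) \<in> carrier R" if "\<rho> \<in> T" for \<rho>
        using cT[OF that] cl[OF insertI2[OF that] b(1)] \<tau>b by simp
      fix a assume a: "a \<in> carrier R"
      note ba = m_closed[OF b(1) a]
      have f: "(\<lambda>\<rho>. c \<rho> \<otimes> \<rho> (b \<otimes> a)) \<in> T \<rightarrow> carrier R" "(\<lambda>\<rho>. c \<rho> \<otimes> \<rho> a) \<in> T \<rightarrow> carrier R"
        "(\<lambda>\<rho>. (\<ominus> \<tau> b) \<otimes> (c \<rho> \<otimes> \<rho> a)) \<in> T \<rightarrow> carrier R"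
        using cT cl[OF insertI2 a] cl[OF insertI2 ba] \<tau>b by auto
      have "c \<rho> \<otimes> (\<rho> b \<ominus> \<tau> b) \<otimes> \<rho> a = c \<rho> \<otimes> \<rho> (b \<otimes> a) \<oplus> (\<ominus> \<tau> b) \<otimes> (c \<rho> \<otimes> \<rho> a)"
        if \<rho>: "\<rho> \<in> T" for \<rho>
      proof -
        have "\<rho> (b \<otimes> a) = \<rho> b \<otimes> \<rho> a" using hom[OF insertI2[OF \<rho>]] a b(1) by (auto dest: ring_hom_mult)
        then show ?thesis
          using cT[OF \<rho>] cl[OF insertI2[OF \<rho>] a] cl[OF insertI2[OF \<rho>] b(1)] \<tau>b by algebra
      qed
      then have "(\<Oplus>\<rho>\<in>T. c \<rho> \<otimes> (\<rho> b \<ominus> \<tau> b) \<otimes> \<rho> a) =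
          (\<Oplus>\<rho>\<in>T. c \<rho> \<otimes> \<rho> (b \<otimes> a) \<oplus> (\<ominus> \<tau> b) \<otimes> (c \<rho> \<otimes> \<rho> a))"
        using f by (intro finsum_cong') auto
      also have "\<dots> = (\<Oplus>\<rho>\<in>T. c \<rho> \<otimes> \<rho> (b \<otimes> a)) \<oplus> (\<ominus> \<tau> b) \<otimes> (\<Oplus>\<rho>\<in>T. c \<rho> \<otimes> \<rho> a)"
        using f \<tau>b insert.hyps(1) by (simp add: finsum_addf finsum_rdistr)
      also have "\<dots> = \<zero>"
      proof -
        have "\<tau> (b \<otimes> a) = \<tau> b \<otimes> \<tau> a" using hom[OF insertI1] a b(1) by (auto dest: ring_hom_mult)
        then have "\<ominus> (c \<tau> \<otimes> (\<tau> b \<otimes> \<tau> a)) = (\<Oplus>\<rho>\<in>T. c \<rho> \<otimes> \<rho> (b \<otimes> a))"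
          using split[OF ba] finsum_closed[OF f(1)] cc[OF insertI1] cl[OF insertI1 a] \<tau>b
          by (intro minus_equality) (simp_all add: a_comm)
        moreover have "\<ominus> (c \<tau> \<otimes> \<tau> a) = (\<Oplus>\<rho>\<in>T. c \<rho> \<otimes> \<rho> a)"
          using split[OF a] finsum_closed[OF f(2)] cc[OF insertI1] cl[OF insertI1 a]
          by (intro minus_equality) (simp_all add: a_comm)
        moreover have "\<ominus> (c \<tau> \<otimes> (\<tau> b \<otimes> \<tau> a)) \<oplus> (\<ominus> \<tau> b) \<otimes> (\<ominus> (c \<tau> \<otimes> \<tau> a)) = \<zero>"
          using cc[OF insertI1] cl[OF insertI1 a] \<tau>b by algebra
        ultimately show ?thesis by simp
      qed
      finally show "(\<Oplus>\<rho>\<in>T. c \<rho> \<otimes> (\<rho> b \<ominus> \<tau> b) \<otimes> \<rho> a) = \<zero>" .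
    qed
    then have "c \<sigma> \<otimes> (\<sigma> b \<ominus> \<tau> b) = \<zero>" using \<sigma> by blast
    moreover have "\<sigma> b \<ominus> \<tau> b \<noteq> \<zero>"
      using b(2) cl[OF insertI2[OF \<sigma>] b(1)] \<tau>b r_right_minus_eq by blast
    ultimately show ?thesis
      using integral_iff[OF cT[OF \<sigma>]] cl[OF insertI2[OF \<sigma>] b(1)] \<tau>b by auto
  qed
  \<comment> \<open>All other coefficients vanish, so evaluating the original relation at 1 isolates
    the coefficient of \<open>\<tau>\<close>.\<close>
  have "(\<Oplus>\<sigma>\<in>T. c \<sigma> \<otimes> \<sigma> \<one>) = (\<Oplus>\<sigma>\<in>T. \<zero>)"
    using zero cl by (intro finsum_cong') auto
  then have "c \<tau> \<otimes> \<tau> \<one> = \<zero>" using split[of \<one>] cc cl[OF insertI1] by simp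
  moreover have "\<tau> \<one> = \<one>" using hom[OF insertI1] by (auto dest: ring_hom_one)
  ultimately have "c \<tau> = \<zero>" using cc by simp
  then show ?case using zero by blast
qed simp

text \<open>An automorphism over \<open>K\<close> is determined by its values on a finite spanning
  list, and each of these values is a root of a nonzero polynomial over \<open>K\<close> chosen for
  the list entry. Hence there are finitely many possibilities.\<close>

lemma (in field) finite_galois_group:
  assumes K: "subfield K R" and fin: "finite_dimension K (carrier R)"
  shows "finite (carrier (galois_group K))"
proof -
  have KR: "K \<subseteq> carrier R" using subfieldE(3)[OF K] .
  obtain n where "dimension n K (carrier R)" using fin by blast
  then obtain Us where Us: "set Us \<subseteq> carrier R" "Span K Us = carrier R"
    using exists_base[OF K] by blast
  have roots: "\<exists>Q. finite Q \<and> (\<forall>\<sigma>\<in>carrier (galois_group K). \<sigma> x \<in> Q)" if x: "x \<in> carrier R" for x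
  proof -
    have "(algebraic over K) x"
      by (rule finite_dimension_imp_algebraic[OF K carrier_is_subring fin x])
    then obtain p where p: "p \<in> carrier (K[X])" "p \<noteq> []" "eval p x = \<zero>"
      by (rule algebraicE[OF subfieldE(1)[OF K] x])
    have pK: "set p \<subseteq> K" using p(1) polynomial_incl unfolding univ_poly_carrier[symmetric] by blast
    have "is_root p (\<sigma> x)" if \<sigma>: "\<sigma> \<in> carrier (galois_group K)" for \<sigma>
    proof -
      interpret \<sigma>: ring_hom_ring R R \<sigma>
        using galois_groupD(1)[OF \<sigma>] ring_axioms by (simp add: ring_hom_ring_def ring_hom_ring_axioms_def)
      \<comment> \<open>The coefficients lie in \<open>K\<close> and are fixed, so
        \<open>\<sigma>\<close> sends roots of \<open>p\<close> to roots of
        \<open>p\<close>.\<close>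
      have "map \<sigma> p = p"
        using \<sigma> pK by (intro map_idI) (auto simp: galois_group_def)
      then show ?thesis
        using \<sigma>.eval_hom'[OF x, of p] \<sigma>.hom_closed[OF x] pK KR p by (auto simp: is_root_def)
    qed
    moreover have "finite {y. is_root p y}"
      by (rule finite_number_of_roots[OF carrier_polynomial_shell[OF subfieldE(1)[OF K] p(1)]])
    ultimately show ?thesis by blast
  qed
  obtain Q where Q: "\<And>x. x \<in> carrier R \<Longrightarrow> finite (Q x)"
    "\<And>x \<sigma>. x \<in> carrier R \<Longrightarrow> \<sigma> \<in> carrier (galois_group K) \<Longrightarrow> \<sigma> x \<in> Q x"
    using roots by metis
  have "finite (\<Union>x\<in>set Us. Q x)" using Q(1) Us(1) by blast
  then have "finite {xs. set xs \<subseteq> (\<Union>x\<in>set Us. Q x) \<and> length xs = length Us}"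
    by (rule finite_lists_length_eq)
  moreover have "(\<lambda>\<sigma>. map \<sigma> Us) ` carrier (galois_group K) \<subseteq>
      {xs. set xs \<subseteq> (\<Union>x\<in>set Us. Q x) \<and> length xs = length Us}"
  proof (rule image_subsetI)
    fix \<sigma> assume \<sigma>: "\<sigma> \<in> carrier (galois_group K)"
    have "\<sigma> x \<in> (\<Union>x\<in>set Us. Q x)" if "x \<in> set Us" for x
      using Q(2)[OF _ \<sigma>, of x] Us(1) that by blast
    then show "map \<sigma> Us \<in> {xs. set xs \<subseteq> (\<Union>x\<in>set Us. Q x) \<and> length xs = length Us}"
      by auto
  qed
  ultimately have "finite ((\<lambda>\<sigma>. map \<sigma> Us) ` carrier (galois_group K))"
    by (rule finite_subset[rotated])
  moreover have "inj_on (\<lambda>\<sigma>. map \<sigma> Us) (carrier (galois_group K))"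
  proof (rule inj_onI)
    fix \<sigma> \<tau> assume \<sigma>: "\<sigma> \<in> carrier (galois_group K)" and \<tau>: "\<tau> \<in> carrier (galois_group K)"
      and eq: "map \<sigma> Us = map \<tau> Us"
    have comb: "\<rho> (combine Ks Vs) = combine Ks (map \<rho> Vs)"
      if \<rho>: "\<rho> \<in> carrier (galois_group K)" and "set Ks \<subseteq> K" "set Vs \<subseteq> carrier R" for \<rho> Ks Vs
    proof -
      interpret \<rho>: ring_hom_ring R R \<rho>
        using galois_groupD(1)[OF \<rho>] ring_axioms by (simp add: ring_hom_ring_def ring_hom_ring_axioms_def)
      show ?thesis
        using that(2,3)
      proof (induction Ks Vs rule: combine.induct)
        case (1 k Ks u Us)
        then have "k \<in> K" "k \<in> carrier R" "u \<in> carrier R" "combine Ks Us \<in> carrier R" "\<rho> k = k"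
          using KR \<rho> combine_in_carrier[of Ks Us] by (auto simp: galois_group_def)
        then show ?case using 1 by simp
      qed simp_all
    qed
    show "\<sigma> = \<tau>"
    proof (rule extensionalityI[of _ "carrier R"])
      show "\<sigma> \<in> extensional (carrier R)" "\<tau> \<in> extensional (carrier R)"
        using galois_groupD(2) \<sigma> \<tau> by (auto simp: Bij_def)
      fix a assume "a \<in> carrier R"
      then obtain Ks where "set Ks \<subseteq> K" "a = combine Ks Us"
        using Us Span_eq_combine_set[OF K Us(1)] by auto
      then show "\<sigma> a = \<tau> a" using comb[OF \<sigma> _ Us(1)] comb[OF \<tau> _ Us(1)] eq by simp
    qed
  qed
  ultimately show ?thesis by (rule finite_imageD)
qed

section \<open>Hilbert 90 for the units of a modification\<close>

context galois_modification begin

lemma hilbert90_Units: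
  assumes fin: "finite (Units S)"
    and c: "\<And>u. u \<in> Units S \<Longrightarrow> c u \<in> carrier L - {\<zero>\<^bsub>L\<^esub>}"
    and coc: "\<And>u v. u \<in> Units S \<Longrightarrow> v \<in> Units S \<Longrightarrow> c (u \<otimes>\<^bsub>S\<^esub> v) = u (c v) \<otimes>\<^bsub>L\<^esub> c u"
  shows "\<exists>b \<in> carrier L - {\<zero>\<^bsub>L\<^esub>}. \<forall>u \<in> Units S. c u \<otimes>\<^bsub>L\<^esub> b = u b"
proof -
  \<comment> \<open>A nonzero value of the Poincare series; its inverse is the required element.\<close>
  define d where "d a = (\<Oplus>\<^bsub>L\<^esub>u\<in>Units S. c u \<otimes>\<^bsub>L\<^esub> u a)" for a
  have hom: "ring_hom_ring L L u" "u \<in> ring_hom L L" "u \<in> Bij (carrier L)" if "u \<in> Units S" for u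
    using elem_hom[OF unit_nonzero[OF that]] by blast+
  have cl: "u a \<in> carrier L" if "u \<in> Units S" "a \<in> carrier L" for u a
    using ring_hom_closed[OF hom(2)[OF that(1)] that(2)] .
  \<comment> \<open>Otherwise independence would force \<open>c\<close> to vanish on the units,
    which contain 1, while its values are nonzero.\<close>
  have "\<exists>a \<in> carrier L. d a \<noteq> \<zero>\<^bsub>L\<^esub>"
  proof (rule ccontr)
    assume "\<not> ?thesis"
    then have "\<forall>u \<in> Units S. c u = \<zero>\<^bsub>L\<^esub>"
      using hom c unfolding d_def by (intro L.ring_homs_independent[OF fin]) (auto simp: Bij_def)
    then show False using c S.Units_one_closed by blast
  qed
  then obtain a where a: "a \<in> carrier L" and d0: "d a \<noteq> \<zero>\<^bsub>L\<^esub>" by blast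
  have f: "(\<lambda>u. c u \<otimes>\<^bsub>L\<^esub> u a) \<in> Units S \<rightarrow> carrier L" using c cl a by auto
  have d: "d a \<in> carrier L - {\<zero>\<^bsub>L\<^esub>}" unfolding d_def using L.finsum_closed[OF f] d0 d_def by simp
  \<comment> \<open>By the cocycle identity, applying \<open>v\<close> and multiplying by
    \<open>c v\<close> turns the summand of \<open>u\<close> into that of \<open>v u\<close>, and
    left translation by \<open>v\<close> permutes the units.\<close>
  have inv: "c v \<otimes>\<^bsub>L\<^esub> v (d a) = d a" if v: "v \<in> Units S" for v
  proof -
    interpret v: ring_hom_ring L L v by (rule hom(1)[OF v])
    have summand: "c v \<otimes>\<^bsub>L\<^esub> v (c u \<otimes>\<^bsub>L\<^esub> u a) = c (v \<otimes>\<^bsub>S\<^esub> u) \<otimes>\<^bsub>L\<^esub> (v \<otimes>\<^bsub>S\<^esub> u) a" if u: "u \<in> Units S" for u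
    proof -
      have "v (u a) = (v \<otimes>\<^bsub>S\<^esub> u) a"
        using unit_nonzero[OF S.Units_m_closed[OF v u]]
        by (intro elem_apply_mult unit_nonzero v u a) auto
      then show ?thesis
        using coc[OF v u] c[OF u] c[OF v] cl[OF u a] cl[OF v cl[OF u a]]
          cl[OF v, of "c u"] by (simp add: L.m_ac)
    qed
    have img: "(\<lambda>u. v \<otimes>\<^bsub>S\<^esub> u) ` Units S = Units S"
    proof (intro equalityI subsetI)
      fix w assume w: "w \<in> Units S"
      have "w = v \<otimes>\<^bsub>S\<^esub> (inv\<^bsub>S\<^esub> v \<otimes>\<^bsub>S\<^esub> w)"
        using v w S.Units_closed S.m_assoc[of v "inv\<^bsub>S\<^esub> v" w] S.Units_r_inv[OF v] by simp
      then show "w \<in> (\<lambda>u. v \<otimes>\<^bsub>S\<^esub> u) ` Units S" using S.Units_m_closed v w by blast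
    qed (use v in auto)
    have inj: "inj_on (\<lambda>u. v \<otimes>\<^bsub>S\<^esub> u) (Units S)"
      using S.Units_l_cancel[OF v] S.Units_closed by (intro inj_onI) simp
    have "c v \<otimes>\<^bsub>L\<^esub> v (d a) = c v \<otimes>\<^bsub>L\<^esub> (\<Oplus>\<^bsub>L\<^esub>u\<in>Units S. v (c u \<otimes>\<^bsub>L\<^esub> u a))"
      unfolding d_def using v.hom_finsum[OF f] by (simp add: comp_def)
    also have "\<dots> = (\<Oplus>\<^bsub>L\<^esub>u\<in>Units S. c v \<otimes>\<^bsub>L\<^esub> v (c u \<otimes>\<^bsub>L\<^esub> u a))"
      using v.hom_closed[OF funcset_mem[OF f]] c[OF v] by (intro L.finsum_rdistr fin) auto
    also have "\<dots> = (\<Oplus>\<^bsub>L\<^esub>u\<in>Units S. c (v \<otimes>\<^bsub>S\<^esub> u) \<otimes>\<^bsub>L\<^esub> (v \<otimes>\<^bsub>S\<^esub> u) a)"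
      using funcset_mem[OF f S.Units_m_closed[OF v]] by (intro L.finsum_cong' refl summand) auto
    also have "\<dots> = (\<Oplus>\<^bsub>L\<^esub>u\<in>(\<lambda>u. v \<otimes>\<^bsub>S\<^esub> u) ` Units S. c u \<otimes>\<^bsub>L\<^esub> u a)"
      by (rule L.finsum_reindex[symmetric]) (use f inj img in simp_all)
    finally show ?thesis unfolding img d_def .
  qed
  have dU: "d a \<in> Units L" using d L.field_Units by simp
  let ?b = "inv\<^bsub>L\<^esub> d a"
  have b: "?b \<in> carrier L - {\<zero>\<^bsub>L\<^esub>}"
    using L.Units_inv_Units[OF dU] L.field_Units by simp
  have "c v \<otimes>\<^bsub>L\<^esub> ?b = v ?b" if v: "v \<in> Units S" for v
  proof -
    interpret v: ring_hom_ring L L v by (rule hom(1)[OF v])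
    have cc: "c v \<in> carrier L" "v (d a) \<in> carrier L" "v ?b \<in> carrier L" "?b \<in> carrier L" "d a \<in> carrier L"
      using c[OF v] cl[OF v] d b by auto
    have one: "v (d a) \<otimes>\<^bsub>L\<^esub> v ?b = \<one>\<^bsub>L\<^esub>"
      using v.hom_mult[of "d a" ?b] cc L.Units_r_inv[OF dU] by simp
    have "c v \<otimes>\<^bsub>L\<^esub> ?b = (c v \<otimes>\<^bsub>L\<^esub> ?b) \<otimes>\<^bsub>L\<^esub> (v (d a) \<otimes>\<^bsub>L\<^esub> v ?b)"
      unfolding one using cc by simp
    also have "\<dots> = (c v \<otimes>\<^bsub>L\<^esub> v (d a)) \<otimes>\<^bsub>L\<^esub> ?b \<otimes>\<^bsub>L\<^esub> v ?b"
      using cc by (simp add: L.m_ac del: v.hom_mult)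
    also have "\<dots> = v ?b"
      unfolding inv[OF v] L.Units_r_inv[OF dU] using cc by simp
    finally show ?thesis .
  qed
  then show ?thesis using b by blast
qed

end

section \<open>Specialisation to the multiplicative groups of the fields\<close>

lemma (in galois_modification) modification_module_units:
  assumes fin: "finite (Units S)"
    and norm: "\<forall>x \<in> carrier S. x <#\<^bsub>S\<^esub> Units S = Units S #>\<^bsub>S\<^esub> x"
  shows "modification_module (L.galois_group K) S z (units_of L) (\<lambda>\<sigma>. \<sigma>) coset_act"
    and "(units_of L)\<lparr>carrier := {a \<in> carrier (units_of L). \<forall>u \<in> Units S. u a = a}\<rparr> =
      units_of (L\<lparr>carrier := fixed_elements\<rparr>)"
proof -
  interpret P: field "L\<lparr>carrier := fixed_elements\<rparr>"
    using L.subfield_iff(2)[OF fixed_subfield] .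
  have car: "carrier (units_of L) = carrier L - {\<zero>\<^bsub>L\<^esub>}"
    by (simp add: units_of_carrier L.field_Units)
  \<comment> \<open>The nonzero elements of the fixed field are the fixed elements of the
    multiplicative group, so the two descriptions of the coefficients of the quotient agree as
    records.\<close>
  have "Units (L\<lparr>carrier := fixed_elements\<rparr>) = {a \<in> carrier (units_of L). \<forall>u \<in> Units S. u a = a}"
    unfolding P.field_Units car by auto
  then show eq: "(units_of L)\<lparr>carrier := {a \<in> carrier (units_of L). \<forall>u \<in> Units S. u a = a}\<rparr> =
      units_of (L\<lparr>carrier := fixed_elements\<rparr>)"
    by (simp add: units_of_def)
  show "modification_module (L.galois_group K) S z (units_of L) (\<lambda>\<sigma>. \<sigma>) coset_act"
  proof (intro modification_module.intro modification_module_axioms.intro)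
    show "modification (L.galois_group K) S z" by (rule modification_axioms)
    show "zero_module S z (units_of L) (\<lambda>\<sigma>. \<sigma>)" by (rule units_zero_module)
    show "zero_module (S Mod Units S) {z}
      ((units_of L)\<lparr>carrier := {a \<in> carrier (units_of L). \<forall>u \<in> Units S. u a = a}\<rparr>) coset_act"
      unfolding eq by (rule fixed_units_zero_module[OF norm])
    show "\<forall>x \<in> carrier S. x <#\<^bsub>S\<^esub> Units S = Units S #>\<^bsub>S\<^esub> x" by (rule norm)
    show "coset_act (Units S #>\<^bsub>S\<^esub> x) a = x a"
      if "x \<in> carrier S - {z}" "a \<in> carrier (units_of L)" "\<And>u. u \<in> Units S \<Longrightarrow> u a = a" for x a
      using that by (intro coset_act_eq[OF norm]) (auto simp: car)
    show "\<exists>b \<in> carrier (units_of L). \<forall>u \<in> Units S. c u \<otimes>\<^bsub>units_of L\<^esub> b = u b"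
      if "\<And>u. u \<in> Units S \<Longrightarrow> c u \<in> carrier (units_of L)"
        "\<And>u v. u \<in> Units S \<Longrightarrow> v \<in> Units S \<Longrightarrow> c (u \<otimes>\<^bsub>S\<^esub> v) = u (c v) \<otimes>\<^bsub>units_of L\<^esub> c u" for c
      using hilbert90_Units[OF fin, of c] that unfolding car units_of_mult by blast
  qed
qed

theorem theorem3p1:
  fixes L :: "('l, 'm) ring_scheme" and K :: "'l set"
    and S :: "('l \<Rightarrow> 'l, 'c) monoid_scheme" and z :: "'l \<Rightarrow> 'l"
    and G :: "('l \<Rightarrow> 'l) monoid" and U :: "('l \<Rightarrow> 'l) set" and P :: "'l set"
  assumes "field L" and "subfield K L"
    and "ring.finite_dimension L K (carrier L)"
    and "ring.normal_extension L K"
    and "G = ring.galois_group L K"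
    and "modification G S z"
    and "U = Units S"
    and "\<forall>x \<in> carrier S. x <#\<^bsub>S\<^esub> U = U #>\<^bsub>S\<^esub> x"
    and "P = {l \<in> carrier L. \<forall>u \<in> U. u l = l}"
  shows
    "let H_quot = zero_cohomology (S Mod U) {z} (units_of (L\<lparr>carrier := P\<rparr>)) coset_act 2;
         H_S = zero_cohomology S z (units_of L) (\<lambda>\<sigma>. \<sigma>) 2;
         H_U = group_cohomology (G\<lparr>carrier := U\<rparr>) (units_of L) (\<lambda>\<sigma>. \<sigma>) 2;
         \<psi> = inflation S z (units_of L) (\<lambda>\<sigma>. \<sigma>) (\<lambda>x. U #>\<^bsub>S\<^esub> x) 2;
         \<phi> = restriction (G\<lparr>carrier := U\<rparr>) (units_of L) (\<lambda>\<sigma>. \<sigma>) 2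
     in group_hom H_quot H_S \<psi> \<and> group_hom H_S H_U \<phi> \<and>
        kernel H_quot H_S \<psi> = {\<one>\<^bsub>H_quot\<^esub>} \<and>
        \<psi> ` carrier H_quot = kernel H_S H_U \<phi>"
proof -
  interpret galois_modification L K S z
    using assms(1,2,5,6) by (simp add: galois_modification_def galois_modification_axioms_def)
  \<comment> \<open>Finite dimension makes the Galois group finite; the units lie in it, so the sum
    behind Hilbert 90 is finite.\<close>
  have fin: "finite (Units S)"
    using finite_subset[OF Units_subset L.finite_galois_group[OF assms(2,3)]] .
  note norm = assms(8)[unfolded assms(7)]
  interpret modification_module "L.galois_group K" S z "units_of L" "\<lambda>\<sigma>. \<sigma>" coset_act
    by (rule modification_module_units(1)[OF fin norm])
  show ?thesis
    unfolding Let_def assms(5,7,9) modification_module_units(2)[OF fin norm, symmetric]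
    by (intro conjI inflation_restriction)
qed

end
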